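(* Let $k$ be a field of characteristic different from $2$, $G$ a finite group, $\omega$ a normalized $3$-cocycle on $G$ with values in $k^*$, and $k^G_\omega$ the associated quasi-Hopf algebra of functions on $G$. The non-trivial $2$-dimensional braided Hopf algebras in ${}_{k^G_\omega}^{k^G_\omega}\mathcal{YD}$ (considered up to isomorphism) are in one-to-one correspondence with couples $(\mathfrak{g},\rho)$ consisting of an element $\mathfrak{g}$ in the center of $G$ and a map $\rho:G\to k^*$ obeying $\rho(e)=1$, $\rho(\mathfrak{g})=-1$ and $\flat_{\mathfrak g}\omega=\partial\rho$, where for $x,y\in G$ $$\flat_{\mathfrak g}\omega(x,y)=\frac{\omega(\mathfrak g,x,y)\,\omega(x,y,\mathfrak g)}{\omega(x,\mathfrak g,y)},\qquad \partial\rho(x,y)=\rho(xy)^{-1}\rho(x)\rho(y).$$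
   Context: A quasi-bialgebra is $(H,\Delta,\varepsilon,\Phi)$ with $H$ a unital associative $k$-algebra, $\Phi\in H^{\otimes 3}$ invertible, $\Delta,\varepsilon$ algebra maps such that $(\mathrm{id}\otimes\Delta)\Delta(h)=\Phi(\Delta\otimes\mathrm{id})(\Delta(h))\Phi^{-1}$, $(\mathrm{id}\otimes\varepsilon)\Delta=\mathrm{id}=(\varepsilon\otimes\mathrm{id})\Delta$, $(\mathrm{id}\otimes\varepsilon\otimes\mathrm{id})(\Phi)=1\otimes1$, $(1\otimes\Phi)(\mathrm{id}\otimes\Delta\otimes\mathrm{id})(\Phi)(\Phi\otimes1)=(\mathrm{id}\otimes\mathrm{id}\otimes\Delta)(\Phi)(\Delta\otimes\mathrm{id}\otimes\mathrm{id})(\Phi)$; it is quasi-Hopf if there are an algebra anti-morphism $S$ and $\alpha,\beta\in H$ with $S(h_1)\alpha h_2=\varepsilon(h)\alpha$, $h_1\beta S(h_2)=\varepsilon(h)\beta$, $X^1\beta S(X^2)\alpha X^3=1$, $S(x^1)\alpha x^2\beta S(x^3)=1$. Notation: $\Delta(h)=h_1\otimes h_2$, $\Phi=X^1\otimes X^2\otimes X^3=Y^1\otimes Y^2\otimes Y^3$, $\Phi^{-1}=x^1\otimes x^2\otimes x^3$ (summation understood; different letters are independent copies). A left Yetter-Drinfeld module over $H$ is a left $H$-module $M$ with a map $M\to H\otimes M$, $m\mapsto m_{[-1]}\otimes m_{[0]}$, such that $\varepsilon(m_{[-1]})m_{[0]}=m$, $X^1m_{[-1]}\otimes(X^2\cdot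 m_{[0]})_{[-1]}X^3\otimes(X^2\cdot m_{[0]})_{[0]}=X^1((Y^1\cdot m)_{[-1]})_1Y^2\otimes X^2((Y^1\cdot m)_{[-1]})_2Y^3\otimes X^3\cdot(Y^1\cdot m)_{[0]}$, and $h_1m_{[-1]}\otimes h_2\cdot m_{[0]}=(h_1\cdot m)_{[-1]}h_2\otimes(h_1\cdot m)_{[0]}$. ${}_H^H\mathcal{YD}$ is braided monoidal with diagonal action, coaction $m\otimes n\mapsto X^1(x^1Y^1\cdot m)_{[-1]}x^2(Y^2\cdot n)_{[-1]}Y^3\otimes X^2\cdot(x^1Y^1\cdot m)_{[0]}\otimes X^3x^3\cdot(Y^2\cdot n)_{[0]}$, associativity constraint $(m\otimes n)\otimes p\mapsto X^1\cdot m\otimes(X^2\cdot n\otimes X^3\cdot p)$, trivial unit object $k$, braiding $m\otimes n\mapsto m_{[-1]}\cdot n\otimes m_{[0]}$. A braided Hopf algebra is a Hopf algebra in this category. "Non-trivial" ($2$-dimensional) means not isomorphic to the group Hopf algebra $k[C_2]$ of the cyclic group of order two with trivial action (via $\varepsilon$) and trivial coaction (via $1_H$). A normalized $3$-cocycle is $\omega:G^3\to k^*$ with $\omega(x,y,z)=1$ if one of $x,y,z$ is the neutral element $e$, and $\omega(y,z,t)\omega(x,yz,t)\omega(x,y,z)=\omega(x,y,zt)\omega(xy,z,t)$. With $\{P_g\}_{g\in G}$ the basis of $k^G$ dual to the basis $G$ of $k[G]$, $k^G_\omega$ is the algebra $k^G$ (pointwise product) with $\Delta(P_h)=\sum_{xy=h}P_x\otimes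 P_y$, $\varepsilon(P_h)=\delta_{h,e}$, $\Phi=\sum\omega(g_1,g_2,g_3)P_{g_1}\otimes P_{g_2}\otimes P_{g_3}$, $S(P_g)=P_{g^{-1}}$, $\alpha=1$, $\beta=\sum_g\omega(g,g^{-1},g)^{-1}P_g$. The correspondence meant: $(\mathfrak g,\rho)$ corresponds to the $2$-dimensional braided Hopf algebra with basis $\{1,n\}$, action $h\cdot1=\varepsilon(h)1$, $h\cdot n=\sigma(h)n$ where $\sigma(\varphi)=\varphi(\mathfrak g)$, coaction $1\mapsto1\otimes1$, $n\mapsto v\otimes n$ where $v=\sum_{x\in G}\rho(x)P_x$, unit $1$, $n^2=0$, comultiplication $1\mapsto1\otimes1$, $n\mapsto n\otimes1+1\otimes n$, counit $1\mapsto1,n\mapsto0$, antipode $1\mapsto1,n\mapsto-n$. *)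

theory Defs
  imports "HOL-Analysis.Analysis"
begin

section \<open>Tensor calculus for coordinate spaces\<close>

text \<open>
  All vector spaces are coordinate spaces \<open>'k ^ 'i\<close> over the field \<open>'k\<close>, with \<open>'i\<close> a finite index
  type; every finite-dimensional vector space is isomorphic to one of these. The tensor product of
  \<open>'k ^ 'i\<close> and \<open>'k ^ 'j\<close> is \<open>'k ^ ('i \<times> 'j)\<close>. Iterated tensor products differ by bracketing, and the
  rebracketing isomorphisms are always written out; \<open>\<otimes>\<close> associates to the right.
\<close>

abbreviation lin :: "('k::field ^ 'i \<Rightarrow> 'k ^ 'j) \<Rightarrow> bool" where
  "lin \<equiv> Vector_Spaces.linear (*s) (*s)"

abbreviation bvec :: "'i \<Rightarrow> 'k::field ^ 'i" where
  "bvec i \<equiv> axis i 1"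

definition tens :: "'k::field ^ 'i \<Rightarrow> 'k ^ 'j \<Rightarrow> 'k ^ ('i \<times> 'j)"  (infixr \<open>\<otimes>\<close> 75) where
  "u \<otimes> v = (\<chi> p. u $ fst p * v $ snd p)"

definition lin_ext :: "('i \<Rightarrow> 'k ^ 'j) \<Rightarrow> 'k::field ^ 'i \<Rightarrow> 'k ^ 'j" where
  "lin_ext f v = (\<Sum>i\<in>UNIV. v $ i *s f i)"

text \<open>
  For multilinear \<open>f\<close>, \<open>lift2 t f\<close> and \<open>lift3 t f\<close> are the values on \<open>t\<close> of the linear maps determined
  by \<open>a \<otimes> b \<mapsto> f a b\<close> and \<open>a \<otimes> b \<otimes> c \<mapsto> f a b c\<close>. They play the role of Sweedler notation:
  an expression in \<open>h\<^sub>1\<close>, \<open>h\<^sub>2\<close>, where \<open>h\<^sub>1 \<otimes> h\<^sub>2\<close> stands for the element \<open>t\<close>, is written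
  \<open>lift2 t (\<lambda>h1 h2. \<dots>)\<close>.
\<close>

definition lift2 :: "'k::field ^ ('i \<times> 'j) \<Rightarrow> ('k ^ 'i \<Rightarrow> 'k ^ 'j \<Rightarrow> 'k ^ 'l) \<Rightarrow> 'k ^ 'l" where
  "lift2 t f = (\<Sum>i\<in>UNIV. \<Sum>j\<in>UNIV. t $ (i, j) *s f (bvec i) (bvec j))"

definition lift3 ::
  "'k::field ^ ('i \<times> 'j \<times> 'm) \<Rightarrow> ('k ^ 'i \<Rightarrow> 'k ^ 'j \<Rightarrow> 'k ^ 'm \<Rightarrow> 'k ^ 'l) \<Rightarrow> 'k ^ 'l" where
  "lift3 t f = (\<Sum>i\<in>UNIV. \<Sum>j\<in>UNIV. \<Sum>m\<in>UNIV. t $ (i, j, m) *s f (bvec i) (bvec j) (bvec m))"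

definition tmap ::
  "('k::field ^ 'i \<Rightarrow> 'k ^ 'm) \<Rightarrow> ('k ^ 'j \<Rightarrow> 'k ^ 'n) \<Rightarrow> 'k ^ ('i \<times> 'j) \<Rightarrow> 'k ^ ('m \<times> 'n)" where
  "tmap f g t = lift2 t (\<lambda>a b. f a \<otimes> g b)"

definition tmult ::
  "('k::field ^ 'i \<Rightarrow> 'k ^ 'i \<Rightarrow> 'k ^ 'i) \<Rightarrow> ('k ^ 'j \<Rightarrow> 'k ^ 'j \<Rightarrow> 'k ^ 'j)
    \<Rightarrow> 'k ^ ('i \<times> 'j) \<Rightarrow> 'k ^ ('i \<times> 'j) \<Rightarrow> 'k ^ ('i \<times> 'j)" where
  "tmult p q s t = lift2 s (\<lambda>a b. lift2 t (\<lambda>c d. p a c \<otimes> q b d))"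


section \<open>Quasi-bialgebras and quasi-Hopf algebras\<close>

record ('k, 'h) quasi_hopf_data =
  mul :: "('k, 'h::finite) vec \<Rightarrow> ('k, 'h) vec \<Rightarrow> ('k, 'h) vec"
  one :: "('k, 'h) vec"
  cop :: "('k, 'h) vec \<Rightarrow> ('k, 'h \<times> 'h) vec"
  eps :: "('k, 'h) vec \<Rightarrow> 'k"
  Phi :: "('k, 'h \<times> 'h \<times> 'h) vec"
  anti :: "('k, 'h) vec \<Rightarrow> ('k, 'h) vec"
  alpha :: "('k, 'h) vec"
  beta :: "('k, 'h) vec"

definition mul2 where "mul2 H = tmult (mul H) (mul H)"
definition mul3 where "mul3 H = tmult (mul H) (mul2 H)"
definition mul4 where "mul4 H = tmult (mul H) (mul3 H)"

definition is_Phi_inv ::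
  "('k::field, 'h::finite) quasi_hopf_data \<Rightarrow> 'k ^ ('h \<times> 'h \<times> 'h) \<Rightarrow> bool" where
  "is_Phi_inv H P \<longleftrightarrow>
     mul3 H (Phi H) P = one H \<otimes> one H \<otimes> one H \<and> mul3 H P (Phi H) = one H \<otimes> one H \<otimes> one H"

definition Phi_inv :: "('k::field, 'h::finite) quasi_hopf_data \<Rightarrow> 'k ^ ('h \<times> 'h \<times> 'h)" where
  "Phi_inv H = (THE P. is_Phi_inv H P)"

locale quasi_bialgebra =
  fixes H :: "('k::field, 'h::finite) quasi_hopf_data"
  assumes mul_lin_left: "\<And>b. lin (\<lambda>a. mul H a b)"
    and mul_lin_right: "\<And>a. lin (\<lambda>b. mul H a b)"
    and mul_assoc: "mul H (mul H a b) c = mul H a (mul H b c)"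
    and one_mul: "mul H (one H) a = a"
    and mul_one: "mul H a (one H) = a"
    and cop_lin: "lin (cop H)"
    and cop_mul: "cop H (mul H a b) = mul2 H (cop H a) (cop H b)"
    and cop_one: "cop H (one H) = one H \<otimes> one H"
    and eps_lin: "Vector_Spaces.linear (*s) (*) (eps H)"
    and eps_mul: "eps H (mul H a b) = eps H a * eps H b"
    and eps_one: "eps H (one H) = 1"
    and Phi_invertible: "\<exists>P. is_Phi_inv H P"
    and quasi_coassoc:
      "lift2 (cop H h) (\<lambda>h1 h2. h1 \<otimes> cop H h2)
       = mul3 H (mul3 H (Phi H)
           (lift2 (cop H h) (\<lambda>h1 h2. lift2 (cop H h1) (\<lambda>a b. a \<otimes> b \<otimes> h2)))) (Phi_inv H)"
    and counit_right: "lift2 (cop H h) (\<lambda>h1 h2. eps H h2 *s h1) = h"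
    and counit_left: "lift2 (cop H h) (\<lambda>h1 h2. eps H h1 *s h2) = h"
    and Phi_counit: "lift3 (Phi H) (\<lambda>X1 X2 X3. eps H X2 *s (X1 \<otimes> X3)) = one H \<otimes> one H"
    and pentagon:
      "mul4 H (mul4 H (one H \<otimes> Phi H)
           (lift3 (Phi H) (\<lambda>X1 X2 X3. lift2 (cop H X2) (\<lambda>a b. X1 \<otimes> a \<otimes> b \<otimes> X3))))
           (lift3 (Phi H) (\<lambda>X1 X2 X3. X1 \<otimes> X2 \<otimes> X3 \<otimes> one H))
       = mul4 H
           (lift3 (Phi H) (\<lambda>X1 X2 X3. X1 \<otimes> X2 \<otimes> cop H X3))
           (lift3 (Phi H) (\<lambda>X1 X2 X3. lift2 (cop H X1) (\<lambda>a b. a \<otimes> b \<otimes> X2 \<otimes> X3)))"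

locale quasi_hopf_algebra = quasi_bialgebra H
  for H :: "('k::field, 'h::finite) quasi_hopf_data" +
  assumes anti_lin: "lin (anti H)"
    and anti_mul: "anti H (mul H a b) = mul H (anti H b) (anti H a)"
    and anti_one: "anti H (one H) = one H"
    and anti_alpha:
      "lift2 (cop H h) (\<lambda>h1 h2. mul H (mul H (anti H h1) (alpha H)) h2) = eps H h *s alpha H"
    and anti_beta:
      "lift2 (cop H h) (\<lambda>h1 h2. mul H (mul H h1 (beta H)) (anti H h2)) = eps H h *s beta H"
    and Phi_anti:
      "lift3 (Phi H) (\<lambda>X1 X2 X3.
         mul H (mul H (mul H (mul H X1 (beta H)) (anti H X2)) (alpha H)) X3) = one H"
    and Phi_inv_anti:
      "lift3 (Phi_inv H) (\<lambda>x1 x2 x3.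
         mul H (mul H (mul H (mul H (anti H x1) (alpha H)) x2) (beta H)) (anti H x3)) = one H"


section \<open>Yetter-Drinfeld modules and their braided monoidal structure\<close>

record ('k, 'h, 'i) yd_data =
  act :: "('k, 'h::finite) vec \<Rightarrow> ('k, 'i::finite) vec \<Rightarrow> ('k, 'i) vec"
  coact :: "('k, 'i) vec \<Rightarrow> ('k, 'h \<times> 'i) vec"

locale yd_module = quasi_hopf_algebra H
  for H :: "('k::field, 'h::finite) quasi_hopf_data" +
  fixes M :: "('k, 'h, 'i::finite) yd_data"
  assumes act_lin_left: "\<And>m. lin (\<lambda>h. act M h m)"
    and act_lin_right: "\<And>h. lin (\<lambda>m. act M h m)"
    and act_one: "act M (one H) m = m"
    and act_mul: "act M (mul H a b) m = act M a (act M b m)"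
    and coact_lin: "lin (coact M)"
    and coact_counit: "lift2 (coact M m) (\<lambda>m1 m0. eps H m1 *s m0) = m"
    and coact_coassoc:
      "lift3 (Phi H) (\<lambda>X1 X2 X3. lift2 (coact M m) (\<lambda>m1 m0.
         lift2 (coact M (act M X2 m0)) (\<lambda>n1 n0. mul H X1 m1 \<otimes> mul H n1 X3 \<otimes> n0)))
       = lift3 (Phi H) (\<lambda>X1 X2 X3. lift3 (Phi H) (\<lambda>Y1 Y2 Y3.
           lift2 (coact M (act M Y1 m)) (\<lambda>m1 m0. lift2 (cop H m1) (\<lambda>m11 m12.
             mul H (mul H X1 m11) Y2 \<otimes> mul H (mul H X2 m12) Y3 \<otimes> act M X3 m0))))"
    and act_coact:
      "lift2 (cop H h) (\<lambda>h1 h2. lift2 (coact M m) (\<lambda>m1 m0. mul H h1 m1 \<otimes> act M h2 m0))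
       = lift2 (cop H h) (\<lambda>h1 h2.
           lift2 (coact M (act M h1 m)) (\<lambda>m1 m0. mul H m1 h2 \<otimes> m0))"

definition yd_hom ::
  "('k::field, 'h::finite, 'i::finite) yd_data \<Rightarrow> ('k, 'h, 'j::finite) yd_data
    \<Rightarrow> ('k ^ 'i \<Rightarrow> 'k ^ 'j) \<Rightarrow> bool" where
  "yd_hom M N f \<longleftrightarrow> lin f \<and> (\<forall>h m. f (act M h m) = act N h (f m)) \<and>
     (\<forall>m. coact N (f m) = lift2 (coact M m) (\<lambda>m1 m0. m1 \<otimes> f m0))"

definition yd_unit :: "('k::field, 'h::finite) quasi_hopf_data \<Rightarrow> ('k, 'h, 1) yd_data" where
  "yd_unit H = \<lparr>act = (\<lambda>h c. eps H h *s c), coact = (\<lambda>c. one H \<otimes> c)\<rparr>"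

definition yd_tensor ::
  "('k::field, 'h::finite) quasi_hopf_data \<Rightarrow> ('k, 'h, 'i::finite) yd_data
    \<Rightarrow> ('k, 'h, 'j::finite) yd_data \<Rightarrow> ('k, 'h, 'i \<times> 'j) yd_data" where
  "yd_tensor H M N = \<lparr>
     act = (\<lambda>h t. lift2 (cop H h) (\<lambda>h1 h2. tmap (act M h1) (act N h2) t)),
     coact = (\<lambda>t. lift2 t (\<lambda>m n.
       lift3 (Phi H) (\<lambda>X1 X2 X3. lift3 (Phi_inv H) (\<lambda>x1 x2 x3. lift3 (Phi H) (\<lambda>Y1 Y2 Y3.
         lift2 (coact M (act M (mul H x1 Y1) m)) (\<lambda>m1 m0. lift2 (coact N (act N Y2 n)) (\<lambda>n1 n0.
           mul H (mul H (mul H (mul H X1 m1) x2) n1) Y3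
             \<otimes> act M X2 m0 \<otimes> act N (mul H X3 x3) n0)))))))\<rparr>"

definition yd_assoc ::
  "('k::field, 'h::finite) quasi_hopf_data \<Rightarrow> ('k, 'h, 'i::finite) yd_data
    \<Rightarrow> ('k, 'h, 'j::finite) yd_data \<Rightarrow> ('k, 'h, 'l::finite) yd_data
    \<Rightarrow> 'k ^ (('i \<times> 'j) \<times> 'l) \<Rightarrow> 'k ^ ('i \<times> ('j \<times> 'l))" where
  "yd_assoc H M N P t = lift2 t (\<lambda>u p. lift2 u (\<lambda>m n. lift3 (Phi H) (\<lambda>X1 X2 X3.
     act M X1 m \<otimes> (act N X2 n \<otimes> act P X3 p))))"

definition yd_assoc_inv ::
  "('k::field, 'h::finite) quasi_hopf_data \<Rightarrow> ('k, 'h, 'i::finite) yd_data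
    \<Rightarrow> ('k, 'h, 'j::finite) yd_data \<Rightarrow> ('k, 'h, 'l::finite) yd_data
    \<Rightarrow> 'k ^ ('i \<times> ('j \<times> 'l)) \<Rightarrow> 'k ^ (('i \<times> 'j) \<times> 'l)" where
  "yd_assoc_inv H M N P t = lift2 t (\<lambda>m u. lift2 u (\<lambda>n p. lift3 (Phi_inv H) (\<lambda>x1 x2 x3.
     (act M x1 m \<otimes> act N x2 n) \<otimes> act P x3 p)))"

definition yd_braid ::
  "('k::field, 'h::finite, 'i::finite) yd_data \<Rightarrow> ('k, 'h, 'j::finite) yd_data
    \<Rightarrow> 'k ^ ('i \<times> 'j) \<Rightarrow> 'k ^ ('j \<times> 'i)" where
  "yd_braid M N t = lift2 t (\<lambda>m n. lift2 (coact M m) (\<lambda>m1 m0. act N m1 n \<otimes> m0))"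

definition lunit :: "'k::field ^ (1 \<times> 'i) \<Rightarrow> 'k ^ 'i" where
  "lunit t = lift2 t (\<lambda>c m. c $ 1 *s m)"

definition runit :: "'k::field ^ ('i \<times> 1) \<Rightarrow> 'k ^ 'i" where
  "runit t = lift2 t (\<lambda>m c. c $ 1 *s m)"


section \<open>Braided Hopf algebras\<close>

record ('k, 'h, 'i) braided_hopf_data =
  obj :: "('k, 'h::finite, 'i::finite) yd_data"
  bmul :: "('k, 'i \<times> 'i) vec \<Rightarrow> ('k, 'i) vec"
  bunit :: "('k, 1) vec \<Rightarrow> ('k, 'i) vec"
  bcop :: "('k, 'i) vec \<Rightarrow> ('k, 'i \<times> 'i) vec"
  bcounit :: "('k, 'i) vec \<Rightarrow> ('k, 1) vec"
  banti :: "('k, 'i) vec \<Rightarrow> ('k, 'i) vec"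

text \<open>
  The multiplication of the algebra \<open>B \<otimes> B\<close> in the braided category: \<open>m \<otimes> m\<close> after the braiding of
  the two middle factors of \<open>(B \<otimes> B) \<otimes> (B \<otimes> B)\<close>, with the associativity constraints this requires.
\<close>

definition bmul2 ::
  "('k::field, 'h::finite) quasi_hopf_data \<Rightarrow> ('k, 'h, 'i::finite) braided_hopf_data
    \<Rightarrow> 'k ^ (('i \<times> 'i) \<times> ('i \<times> 'i)) \<Rightarrow> 'k ^ ('i \<times> 'i)" where
  "bmul2 H B = (let V = obj B; W = yd_tensor H V V in
     tmap (bmul B) (bmul B)
     \<circ> yd_assoc_inv H V V W
     \<circ> tmap id (yd_assoc H V V V)
     \<circ> tmap id (tmap (yd_braid V V) id)
     \<circ> tmap id (yd_assoc_inv H V V V)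
     \<circ> yd_assoc H V V W)"

locale braided_hopf_algebra =
  fixes H :: "('k::field, 'h::finite) quasi_hopf_data"
    and B :: "('k, 'h, 'i::finite) braided_hopf_data"
  assumes obj_yd: "yd_module H (obj B)"
    and bmul_hom: "yd_hom (yd_tensor H (obj B) (obj B)) (obj B) (bmul B)"
    and bunit_hom: "yd_hom (yd_unit H) (obj B) (bunit B)"
    and bcop_hom: "yd_hom (obj B) (yd_tensor H (obj B) (obj B)) (bcop B)"
    and bcounit_hom: "yd_hom (obj B) (yd_unit H) (bcounit B)"
    and banti_hom: "yd_hom (obj B) (obj B) (banti B)"
    and bmul_assoc:
      "bmul B \<circ> tmap (bmul B) id = bmul B \<circ> tmap id (bmul B) \<circ> yd_assoc H (obj B) (obj B) (obj B)"
    and bmul_unit_left: "bmul B \<circ> tmap (bunit B) id = lunit"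
    and bmul_unit_right: "bmul B \<circ> tmap id (bunit B) = runit"
    and bcop_coassoc:
      "yd_assoc H (obj B) (obj B) (obj B) \<circ> tmap (bcop B) id \<circ> bcop B = tmap id (bcop B) \<circ> bcop B"
    and bcop_counit_left: "lunit \<circ> tmap (bcounit B) id \<circ> bcop B = id"
    and bcop_counit_right: "runit \<circ> tmap id (bcounit B) \<circ> bcop B = id"
    and bcop_mul: "bcop B \<circ> bmul B = bmul2 H B \<circ> tmap (bcop B) (bcop B)"
    and bcop_unit: "bcop B (bunit B 1) = bunit B 1 \<otimes> bunit B 1"
    and bcounit_mul: "bcounit B \<circ> bmul B = lunit \<circ> tmap (bcounit B) (bcounit B)"
    and bcounit_unit: "bcounit B \<circ> bunit B = id"
    and banti_left: "bmul B \<circ> tmap (banti B) id \<circ> bcop B = bunit B \<circ> bcounit B"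
    and banti_right: "bmul B \<circ> tmap id (banti B) \<circ> bcop B = bunit B \<circ> bcounit B"

definition bh_iso ::
  "('k::field, 'h::finite, 'i::finite) braided_hopf_data
    \<Rightarrow> ('k, 'h, 'j::finite) braided_hopf_data \<Rightarrow> bool" where
  "bh_iso A B \<longleftrightarrow> (\<exists>f. bij f \<and> yd_hom (obj A) (obj B) f \<and>
     f \<circ> bmul A = bmul B \<circ> tmap f f \<and> f \<circ> bunit A = bunit B \<and>
     bcop B \<circ> f = tmap f f \<circ> bcop A \<and> bcounit B \<circ> f = bcounit A \<and>
     banti B \<circ> f = f \<circ> banti A)"

text \<open>
  The group Hopf algebra of a finite group, with the group on a type and written additively, as an
  object with trivial action and coaction. The cyclic group of order two is the numeral type \<open>2\<close>
  with its addition modulo two.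
\<close>

definition group_hopf ::
  "('k::field, 'h::finite) quasi_hopf_data \<Rightarrow> ('k, 'h, 'c::{finite, group_add}) braided_hopf_data"
  where
  "group_hopf H = \<lparr>
     obj = \<lparr>act = (\<lambda>h b. eps H h *s b), coact = (\<lambda>b. one H \<otimes> b)\<rparr>,
     bmul = lin_ext (\<lambda>(a, b). bvec (a + b)),
     bunit = lin_ext (\<lambda>_. bvec 0),
     bcop = lin_ext (\<lambda>a. bvec a \<otimes> bvec a),
     bcounit = lin_ext (\<lambda>_. 1),
     banti = lin_ext (\<lambda>a. bvec (- a))\<rparr>"

definition nontrivial_bh2 ::
  "('k::field, 'h::finite) quasi_hopf_data \<Rightarrow> ('k, 'h, 2) braided_hopf_data set" where
  "nontrivial_bh2 H =
     {B. braided_hopf_algebra H B \<and> \<not> bh_iso B (group_hopf H :: ('k, 'h, 2) braided_hopf_data)}"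

definition bh2_iso_rel ::
  "('k::field, 'h::finite) quasi_hopf_data
    \<Rightarrow> (('k, 'h, 2) braided_hopf_data \<times> ('k, 'h, 2) braided_hopf_data) set" where
  "bh2_iso_rel H = {(A, B). A \<in> nontrivial_bh2 H \<and> B \<in> nontrivial_bh2 H \<and> bh_iso A B}"


section \<open>Functions on a finite group twisted by a 3-cocycle\<close>

text \<open>
  The finite group \<open>G\<close> is given by a type of class \<open>group_add\<close>: it is not assumed to be commutative,
  although it is written additively, with neutral element \<open>0\<close>. The space \<open>k\<^sup>G\<close> is \<open>'k ^ 'g\<close>, with
  \<open>bvec g\<close> in the role of \<open>P\<^sub>g\<close>; \<open>*\<close> and \<open>1\<close> on \<open>'k ^ 'g\<close> are the pointwise product and the constant
  function.
\<close>

definition normalized_cocycle3 :: "('g::group_add \<Rightarrow> 'g \<Rightarrow> 'g \<Rightarrow> 'k::field) \<Rightarrow> bool" where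
  "normalized_cocycle3 \<omega> \<longleftrightarrow>
     (\<forall>x y z. \<omega> x y z \<noteq> 0) \<and>
     (\<forall>x y z. x = 0 \<or> y = 0 \<or> z = 0 \<longrightarrow> \<omega> x y z = 1) \<and>
     (\<forall>x y z t. \<omega> y z t * \<omega> x (y + z) t * \<omega> x y z = \<omega> x y (z + t) * \<omega> (x + y) z t)"

definition fun_quasi_hopf ::
  "('g::{finite, group_add} \<Rightarrow> 'g \<Rightarrow> 'g \<Rightarrow> 'k::field) \<Rightarrow> ('k, 'g) quasi_hopf_data" where
  "fun_quasi_hopf \<omega> = \<lparr>
     mul = (*),
     one = 1,
     cop = lin_ext (\<lambda>h. \<Sum>(x, y) \<in> {(x, y). x + y = h}. bvec x \<otimes> bvec y),
     eps = (\<lambda>\<phi>. \<Sum>h\<in>UNIV. \<phi> $ h * (if h = 0 then 1 else 0)),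
     Phi = (\<Sum>x\<in>UNIV. \<Sum>y\<in>UNIV. \<Sum>z\<in>UNIV. \<omega> x y z *s (bvec x \<otimes> bvec y \<otimes> bvec z)),
     anti = lin_ext (\<lambda>g. bvec (- g)),
     alpha = 1,
     beta = (\<Sum>g\<in>UNIV. inverse (\<omega> g (- g) g) *s bvec g)\<rparr>"

definition flat :: "('g \<Rightarrow> 'g \<Rightarrow> 'g \<Rightarrow> 'k::field) \<Rightarrow> 'g \<Rightarrow> 'g \<Rightarrow> 'g \<Rightarrow> 'k" where
  "flat \<omega> g x y = \<omega> g x y * \<omega> x y g / \<omega> x g y"

definition coboundary :: "('g::group_add \<Rightarrow> 'k::field) \<Rightarrow> 'g \<Rightarrow> 'g \<Rightarrow> 'k" where
  "coboundary \<rho> x y = inverse (\<rho> (x + y)) * \<rho> x * \<rho> y"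

definition couples ::
  "('g::group_add \<Rightarrow> 'g \<Rightarrow> 'g \<Rightarrow> 'k::field) \<Rightarrow> ('g \<times> ('g \<Rightarrow> 'k)) set" where
  "couples \<omega> = {(g, \<rho>). (\<forall>x. g + x = x + g) \<and> (\<forall>x. \<rho> x \<noteq> 0) \<and> \<rho> 0 = 1 \<and> \<rho> g = - 1 \<and>
     (\<forall>x y. flat \<omega> g x y = coboundary \<rho> x y)}"

text \<open>
  The braided Hopf algebra with basis \<open>1 = bvec 1\<close>, \<open>n = bvec 2\<close> attached to \<open>(g, \<rho>)\<close>. Here \<open>1\<close>, \<open>2\<close>
  are the two elements of the index type \<open>2\<close>, \<open>\<sigma>(h) = h $ g\<close> and \<open>v = (\<chi> x. \<rho> x)\<close>.
\<close>

definition on_basis :: "'k::field ^ 'j \<Rightarrow> 'k ^ 'j \<Rightarrow> 'k ^ 2 \<Rightarrow> 'k ^ 'j" where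
  "on_basis u w = lin_ext (\<lambda>i. if i = 1 then u else w)"

definition couple_hopf ::
  "('g::{finite, group_add} \<Rightarrow> 'g \<Rightarrow> 'g \<Rightarrow> 'k::field) \<Rightarrow> 'g \<Rightarrow> ('g \<Rightarrow> 'k)
    \<Rightarrow> ('k, 'g, 2) braided_hopf_data" where
  "couple_hopf \<omega> g \<rho> = (let H = fun_quasi_hopf \<omega>; e = bvec 1; n = bvec 2 in \<lparr>
     obj = \<lparr>
       act = (\<lambda>h. on_basis (eps H h *s e) ((h $ g) *s n)),
       coact = on_basis (one H \<otimes> e) ((\<Sum>x\<in>UNIV. \<rho> x *s bvec x) \<otimes> n)\<rparr>,
     bmul = (\<lambda>t. lift2 t (\<lambda>a b. on_basis b (on_basis n 0 b) a)),
     bunit = lin_ext (\<lambda>_. e),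
     bcop = on_basis (e \<otimes> e) (n \<otimes> e + e \<otimes> n),
     bcounit = on_basis 1 0,
     banti = on_basis e (- n)\<rparr>)"

end

theory Submission
  imports Defs
begin

text \<open>
  Let \<open>H = k\<^sup>G\<^sub>\<omega>\<close>. As \<open>k\<^sup>G\<close> is spanned by the orthogonal idempotents \<open>P\<^sub>x\<close>, an \<open>H\<close>-module is a
  \<open>G\<close>-graded space, and a Yetter-Drinfeld module of dimension one is given by a degree \<open>g \<in> G\<close>
  and a function \<open>\<rho>\<close> describing the coaction \<open>n \<mapsto> \<Sum> \<rho>(x) P\<^sub>x \<otimes> n\<close>. A nonzero vector spanning
  such a line is called a weight vector. On weight vectors every structure map of the braided
  category is multiplication by a product of values of \<open>\<omega>\<close> and \<open>\<rho>\<close>. Comparing these scalars in the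
  axioms (\<open>compatible_weight_vector\<close>, \<open>yd_module_of_weight_vectors\<close>) shows that \<open>(g, \<rho>)\<close> defines a
  Yetter-Drinfeld module exactly when \<open>g\<close> is central, \<open>\<rho>\<close> has no zeros, \<open>\<rho>(e) = 1\<close> and
  \<open>\<flat>\<^sub>g\<omega> = \<partial>\<rho>\<close>.

  Let \<open>B\<close> be a braided Hopf algebra of dimension two with unit \<open>u\<close>. The counit is a morphism, so its
  kernel is a subobject of dimension one, spanned by a weight vector \<open>n\<close> for some \<open>(g, \<rho>)\<close>. The
  unit and counit axioms leave only the constants \<open>n\<^sup>2 = c n\<close>,
  \<open>\<Delta>(n) = n \<otimes> u + u \<otimes> n + d (n \<otimes> n)\<close> and \<open>S(n) = s n\<close> (\<open>braided_hopf_algebra_structure\<close>). If \<open>c\<close> or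
  \<open>d\<close> is nonzero, the morphisms \<open>m\<close> and \<open>\<Delta>\<close> force \<open>n\<close> and \<open>n \<otimes> n\<close> to have the same weight, so
  \<open>g = e\<close> and \<open>\<rho> = 1\<close>; then \<open>B\<close> is an ordinary Hopf algebra, comparing \<open>\<Delta>(n\<^sup>2)\<close> with \<open>\<Delta>(n)\<^sup>2\<close> and
  using the antipode gives \<open>c d = -2\<close> and \<open>s = 1\<close>, and \<open>B\<close> is the algebra \<open>k[C\<^sub>2]\<close> with
  \<open>1 + d n\<close> as the generator of \<open>C\<^sub>2\<close>. If \<open>c = d = 0\<close>, the same comparison reads
  \<open>(1 + \<rho>(g)) (n \<otimes> n) = 0\<close>, the second summand coming from the braiding, so \<open>\<rho>(g) = -1\<close>
  (\<open>comult_square\<close>).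

  Conversely these conditions suffice (\<open>braided_hopf_algebra_normal_form\<close>). The structure constants
  determine \<open>B\<close> up to isomorphism (\<open>hopf_form_iso\<close>), and \<open>(g, \<rho>)\<close> is an isomorphism invariant
  because isomorphisms preserve weights and kernels of counits (\<open>hopf_form_iso_weight\<close>). As the
  characteristic is not two, \<open>\<rho>(g) = -1\<close> excludes \<open>\<rho> = 1\<close>, hence \<open>k[C\<^sub>2]\<close>.
\<close>

section \<open>Linear maps and tensors\<close>

lemma lin_iff:
  "lin f \<longleftrightarrow> (\<forall>x y. f (x + y) = f x + f y) \<and> (\<forall>c x. f (c *s x) = c *s f x)"
  by (simp add: Vector_Spaces.linear_iff vec.vector_space_axioms)

lemma linI:
  assumes "\<And>x y. f (x + y) = f x + f y" and "\<And>c x. f (c *s x) = c *s f x"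
  shows "lin f"
  using assms by (simp add: lin_iff)

lemma lin_add: "lin f \<Longrightarrow> f (x + y) = f x + f y"
  by (simp add: lin_iff)

lemma lin_scale: "lin f \<Longrightarrow> f (c *s x) = c *s f x"
  by (simp add: lin_iff)

lemma lin_zero: "lin f \<Longrightarrow> f 0 = 0"
  using lin_scale[of f 0 0] by simp

lemma lin_minus: "lin f \<Longrightarrow> f (- x) = - f x"
  using lin_scale[of f "- 1" x] by simp

lemma lin_diff: "lin f \<Longrightarrow> f (x - y) = f x - f y"
  using lin_add[of f x "- y"] lin_minus[of f y] by simp

lemma lin_sum: "lin f \<Longrightarrow> f (\<Sum>i\<in>I. g i) = (\<Sum>i\<in>I. f (g i))"
  by (induction I rule: infinite_finite_induct) (simp_all add: lin_zero lin_add)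

lemma vec_expand: "v = (\<Sum>i\<in>UNIV. v $ i *s bvec i)"
  by (simp add: vec_eq_iff axis_def if_distrib[of "\<lambda>x. _ * x"] cong: if_cong)

lemma lin_expand: "lin f \<Longrightarrow> f v = (\<Sum>i\<in>UNIV. v $ i *s f (bvec i))"
  by (subst vec_expand[of v]) (simp add: lin_sum lin_scale)

lemma tens_nth [simp]: "(u \<otimes> v) $ (i, j) = u $ i * v $ j"
  by (simp add: tens_def)

lemma bvec_tens: "bvec i \<otimes> bvec j = bvec (i, j)"
  by (auto simp: vec_eq_iff axis_def)

lemma bvec_nth: "bvec i $ j = (if i = j then 1 else 0)"
  by (simp add: axis_def)

lemma tens_scale_left [simp]: "(c *s u) \<otimes> v = c *s (u \<otimes> v)"
  and tens_scale_right [simp]: "u \<otimes> (c *s v) = c *s (u \<otimes> v)"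
  and tens_add_left: "(u + u') \<otimes> v = u \<otimes> v + u' \<otimes> v"
  and tens_add_right: "u \<otimes> (v + v') = u \<otimes> v + u \<otimes> v'"
  and tens_minus_left: "(- u) \<otimes> v = - (u \<otimes> v)"
  and tens_minus_right: "u \<otimes> (- v) = - (u \<otimes> v)"
  and tens_zero_left [simp]: "0 \<otimes> v = 0"
  and tens_zero_right [simp]: "u \<otimes> 0 = 0"
  by (simp_all add: vec_eq_iff tens_def algebra_simps)

text \<open>
  Closure rules that let \<open>intro\<close> decide in which variables a Sweedler expression is linear.
\<close>

named_theorems lin_intros

lemma lin_id [lin_intros]: "lin (\<lambda>x. x)"
  by (simp add: lin_iff)

lemma lin_const_zero [lin_intros]: "lin (\<lambda>x. 0)"
  by (simp add: lin_iff)

lemma lin_comp: "lin f \<Longrightarrow> lin g \<Longrightarrow> lin (\<lambda>x. f (g x))"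
  by (simp add: lin_iff)

lemma lin_comp': "lin f \<Longrightarrow> lin g \<Longrightarrow> lin (f \<circ> g)"
  by (simp add: lin_iff)

lemma lin_plus [lin_intros]: "lin f \<Longrightarrow> lin g \<Longrightarrow> lin (\<lambda>x. f x + g x)"
  by (simp add: lin_iff vec_eq_iff algebra_simps)

lemma lin_scale_const [lin_intros]: "lin f \<Longrightarrow> lin (\<lambda>x. c *s f x)"
  by (simp add: lin_iff vec_eq_iff algebra_simps)

lemma lin_nth_scale [lin_intros]: "lin f \<Longrightarrow> lin (\<lambda>x. f x $ i *s v)"
  by (simp add: lin_iff vec_eq_iff algebra_simps)

lemma lin_tens_left [lin_intros]: "lin f \<Longrightarrow> lin (\<lambda>x. f x \<otimes> v)"
  by (simp add: lin_iff tens_add_left)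

lemma lin_tens_right [lin_intros]: "lin f \<Longrightarrow> lin (\<lambda>x. v \<otimes> f x)"
  by (simp add: lin_iff tens_add_right)

lemma lin_times_left [lin_intros]: "lin f \<Longrightarrow> lin (\<lambda>x. f x * v)"
  by (simp add: lin_iff vec_eq_iff algebra_simps)

lemma lin_times_right [lin_intros]: "lin f \<Longrightarrow> lin (\<lambda>x. v * f x)"
  by (simp add: lin_iff vec_eq_iff algebra_simps)

lemma lin_sum_fun [lin_intros]: "(\<And>i. lin (\<lambda>x. f i x)) \<Longrightarrow> lin (\<lambda>x. \<Sum>i\<in>I. f i x)"
  by (simp add: lin_iff sum.distrib vec.scale_sum_right)

lemma lin_lin_ext [lin_intros]: "lin (lin_ext f)"
  unfolding lin_ext_def by (intro lin_intros)

lemma lin_lift2_arg [lin_intros]: "lin f \<Longrightarrow> lin (\<lambda>x. lift2 (f x) F)"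
  unfolding lift2_def by (intro lin_intros)

lemma lin_lift3_arg [lin_intros]: "lin f \<Longrightarrow> lin (\<lambda>x. lift3 (f x) F)"
  unfolding lift3_def by (intro lin_intros)

lemma lin_lift2_fun [lin_intros]:
  "(\<And>a b. lin (\<lambda>x. F x a b)) \<Longrightarrow> lin (\<lambda>x. lift2 t (F x))"
  unfolding lift2_def by (intro lin_intros)

lemma lin_lift3_fun [lin_intros]:
  "(\<And>a b c. lin (\<lambda>x. F x a b c)) \<Longrightarrow> lin (\<lambda>x. lift3 t (F x))"
  unfolding lift3_def by (intro lin_intros)

lemma lin_tmap_arg [lin_intros]: "lin h \<Longrightarrow> lin (\<lambda>x. tmap f g (h x))"
  unfolding tmap_def by (intro lin_intros)

lemma lin_lift2: "lin (\<lambda>t. lift2 t F)"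
  and lin_tmap: "lin (tmap f g)"
  by (intro lin_intros | simp)+

lemmas lift2_scale = lin_scale[OF lin_lift2]

lemma lin_ext_bvec [simp]: "lin_ext f (bvec i) = f i"
  by (simp add: lin_ext_def bvec_nth vec_eq_iff if_distrib[of "\<lambda>x. x * _"] cong: if_cong)

text \<open>
  Sweedler expressions are defined through coordinates in the standard basis; bilinearity makes
  their value on a pure tensor the expected one.
\<close>

lemma lift2_tens:
  assumes "\<And>b. lin (\<lambda>a. F a b)" and "\<And>a. lin (F a)"
  shows "lift2 (u \<otimes> v) F = F u v"
proof -
  have "F u v = (\<Sum>i\<in>UNIV. u $ i *s (\<Sum>j\<in>UNIV. v $ j *s F (bvec i) (bvec j)))"
    by (subst lin_expand[OF assms(1)], subst lin_expand[OF assms(2)]) simp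
  then show ?thesis
    by (simp add: lift2_def vec.scale_sum_right mult.assoc)
qed

lemma tmap_tens: "lin f \<Longrightarrow> lin g \<Longrightarrow> tmap f g (u \<otimes> v) = f u \<otimes> g v"
  unfolding tmap_def by (subst lift2_tens) (simp_all add: lin_tens_left lin_tens_right)

text \<open>
  The vectors adapted to a Hopf algebra are usually not the standard basis, so identities between
  linear maps are checked on arbitrary spanning sets, and on their tensor products.
\<close>

lemma lin_eq_on_span:
  assumes "lin f" "lin g" "vec.span S = UNIV" "\<And>x. x \<in> S \<Longrightarrow> f x = g x"
  shows "f x = g x"
proof -
  have "x \<in> vec.span S"
    using assms(3) by simp
  then show ?thesis
    by (induction rule: vec.span_induct_alt)
      (simp_all add: lin_zero lin_add lin_scale assms)
qed

lemma span_tens: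
  assumes "vec.span S = UNIV" and "vec.span T = UNIV"
  shows "vec.span {a \<otimes> b | a b. a \<in> S \<and> b \<in> T} = UNIV" (is "vec.span ?P = _")
proof -
  have 1: "a \<otimes> y \<in> vec.span ?P" if "a \<in> S" for a y
  proof -
    have "y \<in> vec.span T"
      using assms(2) by simp
    then show ?thesis
    proof (induction rule: vec.span_induct_alt)
      case base
      then show ?case by (simp add: vec.span_zero)
    next
      case (step c x y)
      then show ?case
        using that vec.span_add[OF vec.span_scale[OF vec.span_base[of "a \<otimes> x" ?P]]]
        by (auto simp: tens_add_right)
    qed
  qed
  have 2: "x \<otimes> y \<in> vec.span ?P" for x y
  proof -
    have "x \<in> vec.span S"
      using assms(1) by simp
    then show ?thesis
    proof (induction rule: vec.span_induct_alt)
      case base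
      then show ?case by (simp add: vec.span_zero)
    next
      case (step c x y)
      then show ?case
        using vec.span_add[OF vec.span_scale[OF 1]] by (simp add: tens_add_left)
    qed
  qed
  have "bvec p \<in> vec.span ?P" for p :: "'b \<times> 'c"
    using 2[of "bvec (fst p)" "bvec (snd p)"] by (simp add: bvec_tens)
  then have "(\<Sum>p\<in>UNIV. t $ p *s bvec p) \<in> vec.span ?P" for t :: "'a ^ ('b \<times> 'c)"
    by (intro vec.span_sum vec.span_scale)
  then have "t \<in> vec.span ?P" for t
    by (rule back_subst[of "\<lambda>t. t \<in> vec.span ?P", OF _ vec_expand[symmetric]])
  then show ?thesis by auto
qed

lemma lin_eq_on_span2:
  assumes "lin f" "lin g" "vec.span S = UNIV" "vec.span T = UNIV"
    "\<And>x y. x \<in> S \<Longrightarrow> y \<in> T \<Longrightarrow> f (x \<otimes> y) = g (x \<otimes> y)"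
  shows "f t = g t"
  by (rule lin_eq_on_span[OF assms(1,2) span_tens[OF assms(3,4)]]) (auto simp: assms(5))

lemma span_pair_expand:
  assumes "vec.span {u, n} = UNIV"
  shows "\<exists>a b. x = a *s u + b *s n"
proof -
  have "x \<in> vec.span {u, n}"
    using assms by simp
  then show ?thesis
    by (auto simp: vec.span_insert vec.span_singleton algebra_simps)
qed

text \<open>
  For expressions built from pointwise products a single pair or triple of basis vectors
  contributes to a given coordinate, because the \<open>P\<^sub>x\<close> are orthogonal idempotents. The coordinate can
  then be read off from the tensor.
\<close>

lemma lift2_delta:
  assumes "\<And>x y. F (bvec x) (bvec y) $ l = (if x = a \<and> y = b then C else 0)"
  shows "lift2 t F $ l = t $ (a, b) * C"
proof -
  have "lift2 t F $ l = (\<Sum>x\<in>UNIV. \<Sum>y\<in>UNIV. if y = b then if x = a then t $ (a, b) * C else 0 else 0)"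
    unfolding lift2_def sum_component by (intro sum.cong refl) (auto simp: assms)
  then show ?thesis by simp
qed

lemma lift3_delta:
  assumes "\<And>x y z. F (bvec x) (bvec y) (bvec z) $ l = (if x = a \<and> y = b \<and> z = c then C else 0)"
  shows "lift3 t F $ l = t $ (a, b, c) * C"
proof -
  have "lift3 t F $ l = (\<Sum>x\<in>UNIV. \<Sum>y\<in>UNIV. \<Sum>z\<in>UNIV.
      if z = c then if y = b then if x = a then t $ (a, b, c) * C else 0 else 0 else 0)"
    unfolding lift3_def sum_component by (intro sum.cong refl) (auto simp: assms)
  then show ?thesis by simp
qed

lemma lift2_component:
  "lift2 t (\<lambda>x y. (x $ a * y $ b) *s v) = t $ (a, b) *s v"
proof -
  have "lift2 t (\<lambda>x y. (x $ a * y $ b) *s v) $ l = t $ (a, b) * v $ l" for l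
    by (rule lift2_delta) (auto simp: bvec_nth)
  then show ?thesis by (simp add: vec_eq_iff)
qed

lemma lift3_component:
  "lift3 t (\<lambda>x y z. (x $ a * y $ b * z $ c) *s v) = t $ (a, b, c) *s v"
proof -
  have "lift3 t (\<lambda>x y z. (x $ a * y $ b * z $ c) *s v) $ l = t $ (a, b, c) * v $ l" for l
    by (rule lift3_delta) (auto simp: bvec_nth)
  then show ?thesis by (simp add: vec_eq_iff)
qed

text \<open>
  When two legs of a tensor enter only through evaluation at a point, what remains is the
  function of the third leg obtained by fixing these points. This is how an associator acts on a
  product of two weight vectors.
\<close>

lemma lift3_slice1:
  assumes "lin L"
  shows "lift3 t (\<lambda>x y z. (y $ b * z $ c) *s L x) = L (\<chi> x. t $ (x, b, c))"
proof -
  have "lift3 t (\<lambda>x y z. (y $ b * z $ c) *s L x) = (\<Sum>x\<in>UNIV. \<Sum>y\<in>UNIV. \<Sum>z\<in>UNIV.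
      if z = c then if y = b then t $ (x, b, c) *s L (bvec x) else 0 else 0)"
    unfolding lift3_def by (intro sum.cong refl) (auto simp: bvec_nth)
  then show ?thesis
    by (subst lin_expand[OF assms]) simp
qed

lemma lift3_slice2:
  assumes "lin L"
  shows "lift3 t (\<lambda>x y z. (x $ a * z $ c) *s L y) = L (\<chi> y. t $ (a, y, c))"
proof -
  have "lift3 t (\<lambda>x y z. (x $ a * z $ c) *s L y) = (\<Sum>x\<in>UNIV. \<Sum>y\<in>UNIV. \<Sum>z\<in>UNIV.
      if z = c then if x = a then t $ (a, y, c) *s L (bvec y) else 0 else 0)"
    unfolding lift3_def by (intro sum.cong refl) (auto simp: bvec_nth)
  also have "\<dots> = (\<Sum>y\<in>UNIV. \<Sum>x\<in>UNIV. if x = a then t $ (a, y, c) *s L (bvec y) else 0)"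
    by (subst sum.swap) simp
  finally show ?thesis
    by (subst lin_expand[OF assms]) simp
qed

lemma lift3_slice3:
  assumes "lin L"
  shows "lift3 t (\<lambda>x y z. (x $ a * y $ b) *s L z) = L (\<chi> z. t $ (a, b, z))"
proof -
  have "lift3 t (\<lambda>x y z. (x $ a * y $ b) *s L z) = (\<Sum>x\<in>UNIV. \<Sum>y\<in>UNIV. \<Sum>z\<in>UNIV.
      if y = b then if x = a then t $ (a, b, z) *s L (bvec z) else 0 else 0)"
    unfolding lift3_def by (intro sum.cong refl) (auto simp: bvec_nth)
  also have "\<dots> = (\<Sum>x\<in>UNIV. \<Sum>z\<in>UNIV. if x = a then t $ (a, b, z) *s L (bvec z) else 0)"
    by (intro sum.cong refl, subst sum.swap) simp
  also have "\<dots> = (\<Sum>z\<in>UNIV. t $ (a, b, z) *s L (bvec z))"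
    by (subst sum.swap) simp
  finally show ?thesis
    by (subst lin_expand[OF assms]) simp
qed


section \<open>The quasi-Hopf algebra of functions on a finite group\<close>

lemma tmult_pointwise: "tmult (*) (*) = (*)"
proof (intro ext, unfold vec_eq_iff, intro allI)
  fix s t :: "'k::field ^ ('i::finite \<times> 'j::finite)" and l :: "'i \<times> 'j"
  obtain i j where l: "l = (i, j)" by (cases l)
  have 1: "lift2 t (\<lambda>c d. (a * c) \<otimes> (b * d)) $ (i, j) = t $ (i, j) * (a $ i * b $ j)" for a b
    by (rule lift2_delta) (auto simp: bvec_nth)
  have "tmult (*) (*) s t $ (i, j) = s $ (i, j) * t $ (i, j)"
    unfolding tmult_def by (rule lift2_delta) (auto simp: bvec_nth 1)
  then show "tmult (*) (*) s t $ l = (s * t) $ l"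
    by (simp add: l)
qed

locale group_cocycle =
  fixes \<omega> :: "'g::{finite, group_add} \<Rightarrow> 'g \<Rightarrow> 'g \<Rightarrow> 'k::field"
  assumes normalized_cocycle: "normalized_cocycle3 \<omega>"
begin

abbreviation H where "H \<equiv> fun_quasi_hopf \<omega>"

lemma cocycle_nonzero [simp]: "\<omega> x y z \<noteq> 0"
  and cocycle_normalized [simp]: "\<omega> 0 y z = 1" "\<omega> x 0 z = 1" "\<omega> x y 0 = 1"
  and cocycle_eq: "\<omega> y z t * \<omega> x (y + z) t * \<omega> x y z = \<omega> x y (z + t) * \<omega> (x + y) z t"
  using normalized_cocycle by (simp_all add: normalized_cocycle3_def)

lemma H_simps [simp]:
  "mul H = (*)" "one H = 1" "alpha H = 1" "eps H \<phi> = \<phi> $ 0" "mul2 H = (*)" "mul3 H = (*)" "mul4 H = (*)"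
  by (simp_all add: fun_quasi_hopf_def mul2_def mul3_def mul4_def tmult_pointwise if_distrib cong: if_cong)

lemma cop_nth [simp]: "cop H h $ (x, y) = h $ (x + y)"
proof -
  have "cop H h $ (x, y) = (\<Sum>i\<in>UNIV. h $ i * (if i = x + y then 1 else 0))"
  proof -
    have "(\<Sum>p\<in>{(a, b). a + b = i}. (case p of (a, b) \<Rightarrow> bvec a \<otimes> bvec b) $ (x, y))
        = (if i = x + y then 1 else (0::'k))" for i
    proof -
      have "(\<Sum>p\<in>{(a, b). a + b = i}. (case p of (a, b) \<Rightarrow> bvec a \<otimes> bvec b) $ (x, y))
          = (\<Sum>p\<in>{(a, b). a + b = i}. if p = (x, y) then 1 else (0::'k))"
        by (intro sum.cong) (auto simp: bvec_nth split: if_splits)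
      then show ?thesis by (auto simp: eq_commute)
    qed
    then show ?thesis
      by (simp add: fun_quasi_hopf_def lin_ext_def)
  qed
  then show ?thesis by (simp add: if_distrib cong: if_cong)
qed

lemma lin_cop [lin_intros]: "lin (cop H)"
  by (simp add: fun_quasi_hopf_def lin_intros)

lemma lin_cop_comp [lin_intros]: "lin f \<Longrightarrow> lin (\<lambda>x. cop H (f x))"
  by (rule lin_comp[OF lin_cop])

lemma Phi_nth [simp]: "Phi H $ (x, y, z) = \<omega> x y z"
proof -
  have "Phi H $ (x, y, z) = (\<Sum>a\<in>UNIV. \<Sum>b\<in>UNIV. \<Sum>c\<in>UNIV.
      if c = z then if b = y then if a = x then \<omega> x y z else 0 else 0 else 0)"
    unfolding fun_quasi_hopf_def quasi_hopf_data.simps sum_component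
    by (intro sum.cong refl) (auto simp: bvec_nth)
  then show ?thesis by simp
qed

lemma anti_nth [simp]: "anti H h $ x = h $ (- x)"
proof -
  have "anti H h $ x = (\<Sum>i\<in>UNIV. if i = - x then h $ i else 0)"
    unfolding fun_quasi_hopf_def quasi_hopf_data.simps lin_ext_def sum_component
    by (intro sum.cong refl) (auto simp: bvec_nth)
  then show ?thesis by simp
qed

lemma beta_nth [simp]: "beta H $ x = inverse (\<omega> x (- x) x)"
  by (simp add: fun_quasi_hopf_def bvec_nth if_distrib cong: if_cong)

text \<open>
  The definite description in the inverse associator is resolved by uniqueness: in a pointwise
  product the inverse is determined coordinate by coordinate.
\<close>

lemma Phi_inv_unique: "is_Phi_inv H P \<longleftrightarrow> P = (\<chi> p. inverse (\<omega> (fst p) (fst (snd p)) (snd (snd p))))"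
  by (auto simp: is_Phi_inv_def vec_eq_iff field_simps)

lemma Phi_inv_nth [simp]: "Phi_inv H $ (x, y, z) = inverse (\<omega> x y z)"
  by (simp add: Phi_inv_def Phi_inv_unique)

text \<open>
  All products are pointwise, so each axiom is compared in coordinates: \<open>\<Delta>\<close> adds two of the
  arguments and \<open>\<Phi>\<close> contributes a value of \<open>\<omega>\<close>. The pentagon becomes the cocycle identity, and
  quasi-coassociativity holds because \<open>H\<close> is commutative and \<open>G\<close> is associative.
\<close>

lemma quasi_hopf_H: "quasi_hopf_algebra H"
proof (intro quasi_hopf_algebra.intro quasi_bialgebra.intro quasi_hopf_algebra_axioms.intro)
  show "lin (\<lambda>a. mul H a b)" "lin (mul H b)" for b
    by (auto intro: lin_intros)
  show "lin (cop H)" "lin (anti H)"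
    by (auto intro: lin_intros simp: lin_iff vec_eq_iff algebra_simps)
  show "Vector_Spaces.linear (*s) (*) (eps H)"
    by (simp add: Vector_Spaces.linear_iff vec.vector_space_axioms
        vector_space_over_itself.vector_space_axioms)
  show "\<exists>P. is_Phi_inv H P"
    by (simp add: Phi_inv_unique)
  show "cop H (one H) = one H \<otimes> one H" "anti H (one H) = one H"
    by (simp_all add: vec_eq_iff)
  show "cop H (mul H a b) = mul2 H (cop H a) (cop H b)" "anti H (mul H a b) = mul H (anti H b) (anti H a)" for a b
    by (simp_all add: vec_eq_iff mult.commute)
  show "mul H (mul H a b) c = mul H a (mul H b c)" for a b c
    by (simp add: mult.assoc)
  show "mul H (one H) a = a" "mul H a (one H) = a" for a
    by simp_all
  show "eps H (mul H a b) = eps H a * eps H b" "eps H (one H) = 1" for a b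
    by simp_all
  have split: "lift2 t (\<lambda>a b. a \<otimes> b \<otimes> w) $ (x, y, l) = t $ (x, y) * w $ l"
    for t :: "'k ^ ('g \<times> 'g)" and w :: "'k ^ 'l::finite" and x y l
    by (rule lift2_delta) (auto simp: bvec_nth)
  show "lift2 (cop H h) (\<lambda>h1 h2. h1 \<otimes> cop H h2)
      = mul3 H (mul3 H (Phi H) (lift2 (cop H h) (\<lambda>h1 h2. lift2 (cop H h1) (\<lambda>a b. a \<otimes> b \<otimes> h2))))
          (Phi_inv H)" for h
  proof -
    have "lift2 (cop H h) (\<lambda>h1 h2. h1 \<otimes> cop H h2) $ (x, y, z) = cop H h $ (x, y + z) * 1" for x y z
      by (rule lift2_delta) (auto simp: bvec_nth)
    moreover have "lift2 (cop H h) (\<lambda>h1 h2. lift2 (cop H h1) (\<lambda>a b. a \<otimes> b \<otimes> h2)) $ (x, y, z)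
        = cop H h $ (x + y, z) * 1" for x y z
      by (rule lift2_delta) (auto simp: bvec_nth split)
    ultimately show ?thesis
      by (simp add: vec_eq_iff add.assoc)
  qed
  show "lift2 (cop H h) (\<lambda>h1 h2. eps H h2 *s h1) = h" for h
  proof -
    have "lift2 (cop H h) (\<lambda>h1 h2. eps H h2 *s h1) $ x = cop H h $ (x, 0) * 1" for x
      by (rule lift2_delta) (auto simp: bvec_nth)
    then show ?thesis by (simp add: vec_eq_iff)
  qed
  show "lift2 (cop H h) (\<lambda>h1 h2. eps H h1 *s h2) = h" for h
  proof -
    have "lift2 (cop H h) (\<lambda>h1 h2. eps H h1 *s h2) $ x = cop H h $ (0, x) * 1" for x
      by (rule lift2_delta) (auto simp: bvec_nth)
    then show ?thesis by (simp add: vec_eq_iff)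
  qed
  show "lift3 (Phi H) (\<lambda>X1 X2 X3. eps H X2 *s (X1 \<otimes> X3)) = one H \<otimes> one H"
  proof -
    have "lift3 (Phi H) (\<lambda>X1 X2 X3. eps H X2 *s (X1 \<otimes> X3)) $ (x, y) = Phi H $ (x, 0, y) * 1" for x y
      by (rule lift3_delta) (auto simp: bvec_nth)
    then show ?thesis by (simp add: vec_eq_iff)
  qed
  show "mul4 H (mul4 H (one H \<otimes> Phi H)
           (lift3 (Phi H) (\<lambda>X1 X2 X3. lift2 (cop H X2) (\<lambda>a b. X1 \<otimes> a \<otimes> b \<otimes> X3))))
           (lift3 (Phi H) (\<lambda>X1 X2 X3. X1 \<otimes> X2 \<otimes> X3 \<otimes> one H))
       = mul4 H
           (lift3 (Phi H) (\<lambda>X1 X2 X3. X1 \<otimes> X2 \<otimes> cop H X3))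
           (lift3 (Phi H) (\<lambda>X1 X2 X3. lift2 (cop H X1) (\<lambda>a b. a \<otimes> b \<otimes> X2 \<otimes> X3)))"
  proof -
    have middle: "lift2 t (\<lambda>a b. v \<otimes> a \<otimes> b \<otimes> w) $ (x, y, z, l) = t $ (y, z) * (v $ x * w $ l)"
      for t :: "'k ^ ('g \<times> 'g)" and v w :: "('k, 'g) vec" and x y z l
      by (rule lift2_delta) (auto simp: bvec_nth)
    have "lift3 (Phi H) (\<lambda>X1 X2 X3. lift2 (cop H X2) (\<lambda>a b. X1 \<otimes> a \<otimes> b \<otimes> X3)) $ (x, y, z, t)
        = Phi H $ (x, y + z, t) * 1" for x y z t
      by (rule lift3_delta) (auto simp: bvec_nth middle)
    moreover have "lift3 (Phi H) (\<lambda>X1 X2 X3. X1 \<otimes> X2 \<otimes> X3 \<otimes> one H) $ (x, y, z, t)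
        = Phi H $ (x, y, z) * 1" for x y z t
      by (rule lift3_delta) (auto simp: bvec_nth)
    moreover have "lift3 (Phi H) (\<lambda>X1 X2 X3. X1 \<otimes> X2 \<otimes> cop H X3) $ (x, y, z, t)
        = Phi H $ (x, y, z + t) * 1" for x y z t
      by (rule lift3_delta) (auto simp: bvec_nth)
    moreover have "lift3 (Phi H) (\<lambda>X1 X2 X3. lift2 (cop H X1) (\<lambda>a b. a \<otimes> b \<otimes> X2 \<otimes> X3)) $ (x, y, z, t)
        = Phi H $ (x + y, z, t) * 1" for x y z t
      by (rule lift3_delta) (auto simp: bvec_nth split)
    ultimately show ?thesis
      by (simp add: vec_eq_iff cocycle_eq)
  qed
  show "lift2 (cop H h) (\<lambda>h1 h2. mul H (mul H (anti H h1) (alpha H)) h2) = eps H h *s alpha H" for h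
  proof -
    have "lift2 (cop H h) (\<lambda>h1 h2. mul H (mul H (anti H h1) (alpha H)) h2) $ x
        = cop H h $ (- x, x) * 1" for x
      by (rule lift2_delta) (auto simp: bvec_nth)
    then show ?thesis by (simp add: vec_eq_iff)
  qed
  show "lift2 (cop H h) (\<lambda>h1 h2. mul H (mul H h1 (beta H)) (anti H h2)) = eps H h *s beta H" for h
  proof -
    have "lift2 (cop H h) (\<lambda>h1 h2. mul H (mul H h1 (beta H)) (anti H h2)) $ x
        = cop H h $ (x, - x) * beta H $ x" for x
      by (rule lift2_delta) (auto simp: bvec_nth)
    then show ?thesis by (simp add: vec_eq_iff)
  qed
  show "lift3 (Phi H) (\<lambda>X1 X2 X3.
         mul H (mul H (mul H (mul H X1 (beta H)) (anti H X2)) (alpha H)) X3) = one H"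
  proof -
    have "lift3 (Phi H) (\<lambda>X1 X2 X3.
         mul H (mul H (mul H (mul H X1 (beta H)) (anti H X2)) (alpha H)) X3) $ x
       = Phi H $ (x, - x, x) * beta H $ x" for x
      by (rule lift3_delta) (auto simp: bvec_nth)
    then show ?thesis by (simp add: vec_eq_iff)
  qed
  show "lift3 (Phi_inv H) (\<lambda>x1 x2 x3.
         mul H (mul H (mul H (mul H (anti H x1) (alpha H)) x2) (beta H)) (anti H x3)) = one H"
  proof -
    have "lift3 (Phi_inv H) (\<lambda>x1 x2 x3.
         mul H (mul H (mul H (mul H (anti H x1) (alpha H)) x2) (beta H)) (anti H x3)) $ x
       = Phi_inv H $ (- x, x, - x) * beta H $ x" for x
      by (rule lift3_delta) (auto simp: bvec_nth)
    \<comment> \<open>the cocycle identity at \<open>(x, -x, x, -x)\<close>, where three of the five factors are normalized\<close>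
    moreover have "\<omega> (- x) x (- x) * \<omega> x (- x) x = 1" for x
      using cocycle_eq[of "- x" x "- x" x] by simp
    ultimately show ?thesis
      by (simp add: vec_eq_iff flip: inverse_mult_distrib)
  qed
qed

end


section \<open>Weight vectors\<close>

definition linear_yd :: "('k::field, 'h::finite, 'i::finite) yd_data \<Rightarrow> bool" where
  "linear_yd M \<longleftrightarrow> (\<forall>m. lin (\<lambda>h. act M h m)) \<and> (\<forall>h. lin (act M h)) \<and> lin (coact M)"

text \<open>
  A nonzero weight vector spans a subobject of dimension one in which \<open>H\<close> acts by evaluation at \<open>a\<close>
  and the coaction is multiplication by \<open>r\<close>.
\<close>

definition weight_vector ::
  "('k::field, 'h::finite, 'i::finite) yd_data \<Rightarrow> 'h \<Rightarrow> 'k ^ 'h \<Rightarrow> 'k ^ 'i \<Rightarrow> bool" where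
  "weight_vector M a r m \<longleftrightarrow> (\<forall>h. act M h m = h $ a *s m) \<and> coact M m = r \<otimes> m"

lemma lin_act_left [lin_intros]: "linear_yd M \<Longrightarrow> lin f \<Longrightarrow> lin (\<lambda>x. act M (f x) m)"
  by (rule lin_comp[of "\<lambda>h. act M h m"]) (auto simp: linear_yd_def)

lemma lin_act_right [lin_intros]: "linear_yd M \<Longrightarrow> lin f \<Longrightarrow> lin (\<lambda>x. act M h (f x))"
  by (rule lin_comp[of "act M h"]) (auto simp: linear_yd_def)

lemma lin_coact [lin_intros]: "linear_yd M \<Longrightarrow> lin f \<Longrightarrow> lin (\<lambda>x. coact M (f x))"
  by (rule lin_comp[of "coact M"]) (auto simp: linear_yd_def)

lemma weight_vector_act: "weight_vector M a r m \<Longrightarrow> act M h m = h $ a *s m"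
  and weight_vector_coact: "weight_vector M a r m \<Longrightarrow> coact M m = r \<otimes> m"
  by (simp_all add: weight_vector_def)

lemma weight_vector_act_scale:
  "linear_yd M \<Longrightarrow> weight_vector M a r m \<Longrightarrow> act M h (c *s m) = (c * h $ a) *s m"
  by (simp add: lin_scale[of "act M h"] linear_yd_def weight_vector_act)

lemma weight_vector_coact_scale:
  "linear_yd M \<Longrightarrow> weight_vector M a r m \<Longrightarrow> coact M (c *s m) = c *s (r \<otimes> m)"
  by (simp add: lin_scale[of "coact M"] linear_yd_def weight_vector_coact)

lemma weight_vector_zero: "linear_yd M \<Longrightarrow> weight_vector M a r 0"
  by (simp add: weight_vector_def linear_yd_def lin_zero)

lemma weight_vector_scale:
  "linear_yd M \<Longrightarrow> weight_vector M a r m \<Longrightarrow> weight_vector M a r (c *s m)"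
  unfolding weight_vector_def by (simp add: linear_yd_def lin_scale mult.commute)

lemma weight_vector_add:
  "linear_yd M \<Longrightarrow> weight_vector M a r m \<Longrightarrow> weight_vector M a r m' \<Longrightarrow> weight_vector M a r (m + m')"
  unfolding weight_vector_def
  by (simp add: linear_yd_def lin_add tens_add_right vec.scale_right_distrib)

text \<open>
  Evaluations at different points are told apart by the idempotents \<open>P\<^sub>a\<close>, and \<open>r \<otimes> m\<close> determines \<open>r\<close>
  as soon as one coordinate of \<open>m\<close> is nonzero.
\<close>

lemma weight_vector_unique:
  assumes "weight_vector M a r m" "weight_vector M b s m" "m \<noteq> 0"
  shows "a = b" "r = s"
proof -
  obtain i where i: "m $ i \<noteq> 0"
    using assms(3) by (auto simp: vec_eq_iff)
  have "(bvec a :: 'a ^ 'b) $ a *s m = (bvec a :: 'a ^ 'b) $ b *s m"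
    using assms(1,2) by (metis weight_vector_act)
  then show "a = b"
    using i by (auto simp: bvec_nth vec_eq_iff split: if_splits)
  have "(r \<otimes> m) $ (x, i) = (s \<otimes> m) $ (x, i)" for x
    using assms(1,2) by (metis weight_vector_coact)
  then show "r = s"
    using i by (simp add: vec_eq_iff)
qed

lemma yd_hom_weight_vector:
  assumes "yd_hom M N f" "weight_vector M a r m"
  shows "weight_vector N a r (f m)"
proof -
  have f: "lin f" "\<And>h m. f (act M h m) = act N h (f m)"
    "\<And>m. coact N (f m) = lift2 (coact M m) (\<lambda>m1 m0. m1 \<otimes> f m0)"
    using assms(1) by (auto simp: yd_hom_def)
  have "coact N (f m) = r \<otimes> f m"
    unfolding f(3) weight_vector_coact[OF assms(2)]
    by (rule lift2_tens) (intro lin_intros f(1))+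
  then show ?thesis
    using assms(2) by (simp add: weight_vector_def lin_scale[OF f(1)] flip: f(2))
qed

text \<open>
  Both conditions on a morphism are linear in the vector, and on a weight vector they say that its
  image has the same weight. The image may be zero, since zero has every weight.
\<close>

lemma yd_homI_weight_vectors:
  assumes "linear_yd M" "linear_yd N" "lin f" and S: "vec.span S = UNIV"
    and w: "\<And>m. m \<in> S \<Longrightarrow> \<exists>a r. weight_vector M a r m \<and> weight_vector N a r (f m)"
  shows "yd_hom M N f"
proof -
  have "f (act M h m) = act N h (f m)" for h m
  proof (rule lin_eq_on_span[OF _ _ S])
    show "lin (\<lambda>m. f (act M h m))"
      by (rule lin_comp[OF assms(3)]) (intro lin_intros assms)
    show "lin (\<lambda>m. act N h (f m))"
      by (intro lin_intros assms)
    show "f (act M h m) = act N h (f m)" if "m \<in> S" for m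
      using w[OF that] by (auto simp: weight_vector_act lin_scale[OF assms(3)])
  qed
  moreover have "coact N (f m) = lift2 (coact M m) (\<lambda>m1 m0. m1 \<otimes> f m0)" for m
  proof (rule lin_eq_on_span[OF _ _ S])
    show "lin (\<lambda>m. coact N (f m))" "lin (\<lambda>m. lift2 (coact M m) (\<lambda>m1 m0. m1 \<otimes> f m0))"
      by (intro lin_intros assms)+
    show "coact N (f m) = lift2 (coact M m) (\<lambda>m1 m0. m1 \<otimes> f m0)" if m: "m \<in> S" for m
    proof -
      obtain a r where "weight_vector M a r m" "weight_vector N a r (f m)"
        using w[OF m] by auto
      then show ?thesis
        using lift2_tens[of "\<lambda>m1 m0. m1 \<otimes> f m0" r m]
        by (simp add: weight_vector_coact lin_intros assms(3))
    qed
  qed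
  ultimately show ?thesis
    using assms(3) by (simp add: yd_hom_def)
qed

context group_cocycle
begin

text \<open>
  The function by which the tensor product of lines \<open>(a, r)\<close> and \<open>(b, s)\<close> coacts. The three factors of
  \<open>\<omega>\<close> come from the two copies of \<open>\<Phi>\<close> and the copy of \<open>\<Phi>\<^sup>-\<^sup>1\<close> in the tensor coaction.
\<close>

definition tensor_weight :: "'g \<Rightarrow> ('k, 'g) vec \<Rightarrow> 'g \<Rightarrow> ('k, 'g) vec \<Rightarrow> ('k, 'g) vec" where
  "tensor_weight a r b s = (\<chi> x. \<omega> x a b * r $ x * inverse (\<omega> a x b) * s $ x * \<omega> a b x)"

lemma linear_yd_tensor:
  assumes "linear_yd M" "linear_yd N"
  shows "linear_yd (yd_tensor H M N)"
  unfolding linear_yd_def yd_tensor_def yd_data.simps by (intro conjI allI lin_intros assms)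

text \<open>
  In the coaction of a tensor product the factors \<open>X\<close>, \<open>x\<close>, \<open>Y\<close> each have two legs acting on the
  modules, where they are evaluated at \<open>a\<close> and \<open>b\<close>, and one leg in \<open>H\<close>: the first leg of \<open>X\<close>, the
  second of \<open>x\<close>, the third of \<open>Y\<close>.
\<close>

lemma weight_vector_tens:
  fixes M :: "('k, 'g, 'i::finite) yd_data" and N :: "('k, 'g, 'j::finite) yd_data"
  assumes M: "linear_yd M" and N: "linear_yd N"
    and m: "weight_vector M a r m" and n: "weight_vector N b s n"
  shows "weight_vector (yd_tensor H M N) (a + b) (tensor_weight a r b s) (m \<otimes> n)"
  unfolding weight_vector_def
proof (intro conjI allI)
  have "tmap (act M h1) (act N h2) (m \<otimes> n) = (h1 $ a * h2 $ b) *s (m \<otimes> n)" for h1 h2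
    using M N by (subst tmap_tens)
      (simp_all add: linear_yd_def weight_vector_act[OF m] weight_vector_act[OF n])
  then show "act (yd_tensor H M N) h (m \<otimes> n) = h $ (a + b) *s (m \<otimes> n)" for h
    by (simp add: yd_tensor_def lift2_component)
  have 1: "lift2 (coact M (act M (x1 * Y1) m)) (\<lambda>m1 m0. lift2 (coact N (act N Y2 n)) (\<lambda>n1 n0.
           (X1 * m1 * x2 * n1 * Y3) \<otimes> act M X2 m0 \<otimes> act N (X3 * x3) n0))
     = (Y1 $ a * Y2 $ b) *s ((x1 $ a * x3 $ b) *s ((X2 $ a * X3 $ b) *s ((X1 * r * x2 * s * Y3) \<otimes> m \<otimes> n)))"
    for X1 X2 X3 x1 x2 x3 Y1 Y2 Y3
  proof -
    have "lift2 (coact M (act M (x1 * Y1) m)) (\<lambda>m1 m0. lift2 (coact N (act N Y2 n)) (\<lambda>n1 n0.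
           (X1 * m1 * x2 * n1 * Y3) \<otimes> act M X2 m0 \<otimes> act N (X3 * x3) n0))
        = (x1 * Y1) $ a *s lift2 (coact N (act N Y2 n)) (\<lambda>n1 n0.
           (X1 * r * x2 * n1 * Y3) \<otimes> act M X2 m \<otimes> act N (X3 * x3) n0)"
      unfolding weight_vector_act[OF m, of "x1 * Y1"] weight_vector_coact_scale[OF M m] lift2_scale
      by (subst lift2_tens) (intro lin_intros M N refl)+
    also have "\<dots> = (x1 * Y1) $ a *s (Y2 $ b *s
        ((X1 * r * x2 * s * Y3) \<otimes> act M X2 m \<otimes> act N (X3 * x3) n))"
      unfolding weight_vector_act[OF n, of Y2] weight_vector_coact_scale[OF N n] lift2_scale
      by (subst lift2_tens) (intro lin_intros M N refl)+
    finally show ?thesis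
      by (simp add: weight_vector_act[OF m] weight_vector_act[OF n] mult_ac)
  qed
  have "lift2 (m \<otimes> n) (\<lambda>m n.
       lift3 (Phi H) (\<lambda>X1 X2 X3. lift3 (Phi_inv H) (\<lambda>x1 x2 x3. lift3 (Phi H) (\<lambda>Y1 Y2 Y3.
         lift2 (coact M (act M (x1 * Y1) m)) (\<lambda>m1 m0. lift2 (coact N (act N Y2 n)) (\<lambda>n1 n0.
           (X1 * m1 * x2 * n1 * Y3) \<otimes> act M X2 m0 \<otimes> act N (X3 * x3) n0))))))
     = lift3 (Phi H) (\<lambda>X1 X2 X3. lift3 (Phi_inv H) (\<lambda>x1 x2 x3. lift3 (Phi H) (\<lambda>Y1 Y2 Y3.
         (Y1 $ a * Y2 $ b) *s ((x1 $ a * x3 $ b) *s ((X2 $ a * X3 $ b) *s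
            ((X1 * r * x2 * s * Y3) \<otimes> m \<otimes> n))))))" (is "?L = _")
    unfolding 1[symmetric] by (subst lift2_tens) (intro lin_intros M N refl)+
  \<comment> \<open>the three associators are contracted from the innermost to the outermost\<close>
  also have "\<dots> = lift3 (Phi H) (\<lambda>X1 X2 X3. lift3 (Phi_inv H) (\<lambda>x1 x2 x3.
         (x1 $ a * x3 $ b) *s ((X2 $ a * X3 $ b) *s
            ((X1 * r * x2 * s * (\<chi> z. \<omega> a b z)) \<otimes> m \<otimes> n))))"
    by (subst lift3_slice3) (intro lin_intros, simp)
  also have "\<dots> = lift3 (Phi H) (\<lambda>X1 X2 X3. (X2 $ a * X3 $ b) *s
            ((X1 * r * (\<chi> y. inverse (\<omega> a y b)) * s * (\<chi> z. \<omega> a b z)) \<otimes> m \<otimes> n))"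
    by (subst lift3_slice2) (intro lin_intros, simp)
  also have "\<dots> = ((\<chi> x. \<omega> x a b) * r * (\<chi> y. inverse (\<omega> a y b)) * s * (\<chi> z. \<omega> a b z)) \<otimes> m \<otimes> n"
    by (subst lift3_slice1) (intro lin_intros, simp)
  also have "\<dots> = tensor_weight a r b s \<otimes> m \<otimes> n"
    by (rule arg_cong[of _ _ "\<lambda>v. v \<otimes> m \<otimes> n"]) (simp add: tensor_weight_def vec_eq_iff)
  finally show "coact (yd_tensor H M N) (m \<otimes> n) = tensor_weight a r b s \<otimes> m \<otimes> n"
    by (simp add: yd_tensor_def)
qed

lemma lin_yd_assoc: "lin (yd_assoc H M N P)"
  and lin_yd_assoc_inv: "lin (yd_assoc_inv H M N P)"
  and lin_yd_braid: "lin (yd_braid M' N')"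
  unfolding yd_assoc_def[abs_def] yd_assoc_inv_def[abs_def] yd_braid_def[abs_def]
  by (intro lin_intros)+

context
  fixes M :: "('k, 'g, 'i::finite) yd_data" and N :: "('k, 'g, 'j::finite) yd_data"
    and P :: "('k, 'g, 'l::finite) yd_data"
  assumes M: "linear_yd M" and N: "linear_yd N" and P: "linear_yd P"
begin

lemma yd_assoc_weight_vectors:
  assumes m: "weight_vector M a r m" and n: "weight_vector N b s n" and p: "weight_vector P c t p"
  shows "yd_assoc H M N P ((m \<otimes> n) \<otimes> p) = \<omega> a b c *s (m \<otimes> (n \<otimes> p))"
proof -
  have "yd_assoc H M N P ((m \<otimes> n) \<otimes> p)
      = lift3 (Phi H) (\<lambda>X1 X2 X3. act M X1 m \<otimes> (act N X2 n \<otimes> act P X3 p))"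
    unfolding yd_assoc_def
    by (subst lift2_tens, (intro lin_intros M N P refl)+)+
  also have "\<dots> = lift3 (Phi H) (\<lambda>X1 X2 X3. (X1 $ a * X2 $ b * X3 $ c) *s (m \<otimes> (n \<otimes> p)))"
    by (simp add: weight_vector_act[OF m] weight_vector_act[OF n] weight_vector_act[OF p] mult_ac)
  finally show ?thesis
    by (simp add: lift3_component)
qed

lemma yd_assoc_inv_weight_vectors:
  assumes m: "weight_vector M a r m" and n: "weight_vector N b s n" and p: "weight_vector P c t p"
  shows "yd_assoc_inv H M N P (m \<otimes> (n \<otimes> p)) = inverse (\<omega> a b c) *s ((m \<otimes> n) \<otimes> p)"
proof -
  have "yd_assoc_inv H M N P (m \<otimes> (n \<otimes> p))
      = lift3 (Phi_inv H) (\<lambda>X1 X2 X3. (act M X1 m \<otimes> act N X2 n) \<otimes> act P X3 p)"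
    unfolding yd_assoc_inv_def
    by (subst lift2_tens, (intro lin_intros M N P refl)+)+
  also have "\<dots> = lift3 (Phi_inv H) (\<lambda>X1 X2 X3. (X1 $ a * X2 $ b * X3 $ c) *s ((m \<otimes> n) \<otimes> p))"
    by (simp add: weight_vector_act[OF m] weight_vector_act[OF n] weight_vector_act[OF p] mult_ac)
  finally show ?thesis
    by (simp add: lift3_component)
qed

end

lemma yd_braid_weight_vectors:
  assumes M: "linear_yd M" and N: "linear_yd N"
    and m: "weight_vector M a r m" and n: "weight_vector N b s n"
  shows "yd_braid M N (m \<otimes> n) = r $ b *s (n \<otimes> m)"
proof -
  have "yd_braid M N (m \<otimes> n) = lift2 (coact M m) (\<lambda>m1 m0. act N m1 n \<otimes> m0)"
    unfolding yd_braid_def by (subst lift2_tens) (intro lin_intros M N refl)+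
  also have "\<dots> = act N r n \<otimes> m"
    unfolding weight_vector_coact[OF m] by (subst lift2_tens) (intro lin_intros M N refl)+
  finally show ?thesis
    by (simp add: weight_vector_act[OF n])
qed

lemma lin_bmul2: "lin (bmul2 H B)"
  unfolding bmul2_def Let_def by (intro lin_comp' lin_tmap lin_yd_assoc lin_yd_assoc_inv)

text \<open>
  The scalar records the path from \<open>(a b) (c d)\<close> to \<open>(a c) (b d)\<close>: two rebracketings, the braiding of
  \<open>b\<close> past \<open>c\<close>, and two rebracketings back.
\<close>

lemma bmul2_weight_vectors:
  fixes B :: "('k, 'g, 'i::finite) braided_hopf_data"
  assumes V: "linear_yd (obj B)" and mul: "lin (bmul B)"
    and a: "weight_vector (obj B) ga ra a" and b: "weight_vector (obj B) gb rb b"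
    and c: "weight_vector (obj B) gc rc c" and d: "weight_vector (obj B) gd rd d"
  shows "bmul2 H B ((a \<otimes> b) \<otimes> (c \<otimes> d))
     = (\<omega> ga gb (gc + gd) * inverse (\<omega> gb gc gd) * rb $ gc * \<omega> gc gb gd * inverse (\<omega> ga gc (gb + gd)))
       *s (bmul B (a \<otimes> c) \<otimes> bmul B (b \<otimes> d))"
proof -
  have lid: "lin id" by (simp add: lin_iff)
  note W = linear_yd_tensor[OF V V]
  note l = lin_yd_assoc lin_yd_assoc_inv lin_yd_braid lin_tmap lid mul
  note sc = lin_scale[OF lin_yd_assoc] lin_scale[OF lin_yd_assoc_inv] lin_scale[OF lin_yd_braid]
    lin_scale[OF lin_tmap]
  show ?thesis
    unfolding bmul2_def Let_def
    by (simp add: sc tmap_tens l yd_assoc_weight_vectors[OF V V W a b weight_vector_tens[OF V V c d]]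
      yd_assoc_inv_weight_vectors[OF V V V b c d] yd_braid_weight_vectors[OF V V b c]
      yd_assoc_weight_vectors[OF V V V c b d]
      yd_assoc_inv_weight_vectors[OF V V W a c weight_vector_tens[OF V V b d]] mult_ac)
qed

end


section \<open>Yetter-Drinfeld modules spanned by weight vectors\<close>

context group_cocycle
begin

text \<open>
  The condition on \<open>(a, r)\<close> for a line of that weight to be a Yetter-Drinfeld module: \<open>r 0 = 1\<close> is
  counitality, commutation with \<open>a\<close> the compatibility of action and coaction, and the last equation
  quasi-coassociativity, which is \<open>\<flat>\<^sub>a\<omega> = \<partial>r\<close> with the denominators cleared.
\<close>

definition compatible :: "'g \<Rightarrow> ('k, 'g) vec \<Rightarrow> bool" where
  "compatible a r \<longleftrightarrow> r $ 0 = 1 \<and> (\<forall>x. r $ x \<noteq> 0 \<and> a + x = x + a) \<and>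
     (\<forall>x y. \<omega> x a y * r $ x * r $ y = \<omega> a x y * \<omega> x y a * r $ (x + y))"

lemma compatible_unit: "compatible 0 1"
  by (simp add: compatible_def)

lemma couples_iff: "(a, \<rho>) \<in> couples \<omega> \<longleftrightarrow> compatible a (\<chi> x. \<rho> x) \<and> \<rho> a = - 1"
proof -
  have "flat \<omega> a x y = coboundary \<rho> x y
      \<longleftrightarrow> \<omega> x a y * \<rho> x * \<rho> y = \<omega> a x y * \<omega> x y a * \<rho> (x + y)" if "\<rho> (x + y) \<noteq> 0" for x y
    using that by (auto simp: flat_def coboundary_def field_simps)
  then show ?thesis
    unfolding couples_def compatible_def by auto
qed

text \<open>
  The two sides of the Yetter-Drinfeld axioms at a weight vector, in coordinates. Each is a scalar
  times a coordinate of the vector, so that the axioms can be both verified and exploited by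
  comparing scalars.
\<close>

context
  fixes M :: "('k, 'g, 'i::finite) yd_data" and a r m
  assumes M: "linear_yd M" and m: "weight_vector M a r m"
begin

lemma coassoc_left_weight_vector:
  "lift3 (Phi H) (\<lambda>X1 X2 X3. lift2 (coact M m) (\<lambda>m1 m0.
     lift2 (coact M (act M X2 m0)) (\<lambda>n1 n0. mul H X1 m1 \<otimes> mul H n1 X3 \<otimes> n0))) $ (x, y, i)
   = \<omega> x a y * r $ x * r $ y * m $ i"
proof -
  have "lift2 (coact M m) (\<lambda>m1 m0.
      lift2 (coact M (act M X2 m0)) (\<lambda>n1 n0. mul H X1 m1 \<otimes> mul H n1 X3 \<otimes> n0))
    = lift2 (coact M (X2 $ a *s m)) (\<lambda>n1 n0. (X1 * r) \<otimes> (n1 * X3) \<otimes> n0)" for X1 X2 X3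
    unfolding weight_vector_coact[OF m] H_simps weight_vector_act[OF m, symmetric]
    by (subst lift2_tens) (intro lin_intros M refl)+
  also have "\<dots> X1 X2 X3 = X2 $ a *s ((X1 * r) \<otimes> (r * X3) \<otimes> m)" for X1 X2 X3
    unfolding weight_vector_coact_scale[OF M m] lift2_scale
    by (subst lift2_tens) (intro lin_intros refl)+
  finally have "lift3 (Phi H) (\<lambda>X1 X2 X3. lift2 (coact M m) (\<lambda>m1 m0.
       lift2 (coact M (act M X2 m0)) (\<lambda>n1 n0. mul H X1 m1 \<otimes> mul H n1 X3 \<otimes> n0))) $ (x, y, i)
     = Phi H $ (x, a, y) * (r $ x * r $ y * m $ i)"
    by (intro lift3_delta) (auto simp: bvec_nth)
  then show ?thesis by simp
qed

lemma coassoc_right_weight_vector: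
  "lift3 (Phi H) (\<lambda>X1 X2 X3. lift3 (Phi H) (\<lambda>Y1 Y2 Y3.
     lift2 (coact M (act M Y1 m)) (\<lambda>m1 m0. lift2 (cop H m1) (\<lambda>m11 m12.
       mul H (mul H X1 m11) Y2 \<otimes> mul H (mul H X2 m12) Y3 \<otimes> act M X3 m0)))) $ (x, y, i)
   = \<omega> a x y * \<omega> x y a * r $ (x + y) * m $ i"
proof -
  have 1: "lift2 (coact M (act M Y1 m)) (\<lambda>m1 m0. lift2 (cop H m1) (\<lambda>m11 m12.
       mul H (mul H X1 m11) Y2 \<otimes> mul H (mul H X2 m12) Y3 \<otimes> act M X3 m0)) $ (x, y, i)
     = Y1 $ a * X3 $ a * r $ (x + y) * (X1 $ x * Y2 $ x * X2 $ y * Y3 $ y * m $ i)"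
    for X1 X2 X3 Y1 Y2 Y3
  proof -
    have "lift2 (coact M (act M Y1 m)) (\<lambda>m1 m0. lift2 (cop H m1) (\<lambda>m11 m12.
         mul H (mul H X1 m11) Y2 \<otimes> mul H (mul H X2 m12) Y3 \<otimes> act M X3 m0))
       = Y1 $ a *s lift2 (cop H r) (\<lambda>m11 m12. (X1 * m11 * Y2) \<otimes> (X2 * m12 * Y3) \<otimes> act M X3 m)"
      unfolding weight_vector_act[OF m, of Y1] weight_vector_coact_scale[OF M m] lift2_scale H_simps
      by (subst lift2_tens) (intro lin_intros M refl)+
    moreover have "lift2 (cop H r) (\<lambda>m11 m12. (X1 * m11 * Y2) \<otimes> (X2 * m12 * Y3) \<otimes> act M X3 m) $ (x, y, i)
       = cop H r $ (x, y) * (X1 $ x * Y2 $ x * X2 $ y * Y3 $ y * X3 $ a * m $ i)"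
      by (rule lift2_delta) (auto simp: bvec_nth weight_vector_act[OF m])
    ultimately show ?thesis by simp
  qed
  have "lift3 (Phi H) (\<lambda>Y1 Y2 Y3.
     lift2 (coact M (act M Y1 m)) (\<lambda>m1 m0. lift2 (cop H m1) (\<lambda>m11 m12.
       mul H (mul H X1 m11) Y2 \<otimes> mul H (mul H X2 m12) Y3 \<otimes> act M X3 m0))) $ (x, y, i)
     = Phi H $ (a, x, y) * (X3 $ a * r $ (x + y) * (X1 $ x * X2 $ y * m $ i))" for X1 X2 X3
    by (rule lift3_delta, subst 1) (auto simp: bvec_nth)
  note 2 = this
  have "lift3 (Phi H) (\<lambda>X1 X2 X3. lift3 (Phi H) (\<lambda>Y1 Y2 Y3.
     lift2 (coact M (act M Y1 m)) (\<lambda>m1 m0. lift2 (cop H m1) (\<lambda>m11 m12.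
       mul H (mul H X1 m11) Y2 \<otimes> mul H (mul H X2 m12) Y3 \<otimes> act M X3 m0)))) $ (x, y, i)
     = Phi H $ (x, y, a) * (Phi H $ (a, x, y) * (r $ (x + y) * m $ i))"
    by (rule lift3_delta, subst 2) (auto simp: bvec_nth)
  then show ?thesis by simp
qed

lemma act_coact_left_weight_vector:
  "lift2 (cop H h) (\<lambda>h1 h2. lift2 (coact M m) (\<lambda>m1 m0. mul H h1 m1 \<otimes> act M h2 m0)) $ (x, i)
   = h $ (x + a) * r $ x * m $ i"
proof -
  have "lift2 (coact M m) (\<lambda>m1 m0. mul H h1 m1 \<otimes> act M h2 m0) = (h1 * r) \<otimes> (h2 $ a *s m)" for h1 h2
    unfolding weight_vector_coact[OF m] H_simps weight_vector_act[OF m, symmetric]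
    by (subst lift2_tens) (intro lin_intros M refl)+
  then have "lift2 (cop H h) (\<lambda>h1 h2. lift2 (coact M m) (\<lambda>m1 m0. mul H h1 m1 \<otimes> act M h2 m0)) $ (x, i)
     = cop H h $ (x, a) * (r $ x * m $ i)"
    by (intro lift2_delta) (auto simp: bvec_nth)
  then show ?thesis by simp
qed

lemma act_coact_right_weight_vector:
  "lift2 (cop H h) (\<lambda>h1 h2. lift2 (coact M (act M h1 m)) (\<lambda>m1 m0. mul H m1 h2 \<otimes> m0)) $ (x, i)
   = h $ (a + x) * r $ x * m $ i"
proof -
  have "lift2 (coact M (act M h1 m)) (\<lambda>m1 m0. mul H m1 h2 \<otimes> m0) = h1 $ a *s ((r * h2) \<otimes> m)" for h1 h2
    unfolding weight_vector_act[OF m] weight_vector_coact_scale[OF M m] lift2_scale H_simps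
    by (subst lift2_tens) (intro lin_intros refl)+
  then have "lift2 (cop H h) (\<lambda>h1 h2. lift2 (coact M (act M h1 m)) (\<lambda>m1 m0. mul H m1 h2 \<otimes> m0)) $ (x, i)
     = cop H h $ (a, x) * (r $ x * m $ i)"
    by (intro lift2_delta) (auto simp: bvec_nth)
  then show ?thesis by simp
qed

lemma counit_weight_vector: "lift2 (coact M m) (\<lambda>m1 m0. eps H m1 *s m0) = r $ 0 *s m"
  unfolding weight_vector_coact[OF m] H_simps by (subst lift2_tens) (intro lin_intros refl)+

end

lemma yd_module_linear_yd: "yd_module H M \<Longrightarrow> linear_yd M"
  unfolding linear_yd_def
  using yd_module.act_lin_left yd_module.act_lin_right yd_module.coact_lin by blast

text \<open>
  Quasi-coassociativity at \<open>(x, -x)\<close> together with \<open>r 0 = 1\<close> shows that \<open>r\<close> has no zero. Only then does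
  the compatibility of action and coaction, tested on \<open>P\<^bsub>x + a\<^esub>\<close>, imply that \<open>x\<close> and \<open>a\<close> commute.
\<close>

lemma compatible_weight_vector:
  assumes yd: "yd_module H M" and m: "weight_vector M a r m" and nz: "m \<noteq> 0"
  shows "compatible a r"
proof -
  note M = yd_module_linear_yd[OF yd]
  obtain i where i: "m $ i \<noteq> 0"
    using nz by (auto simp: vec_eq_iff)
  have 1: "r $ 0 = 1"
    using yd_module.coact_counit[OF yd, of m] counit_weight_vector[OF M m] i
    by (metis (no_types) mult_cancel_right1 vector_smult_component)
  have 2: "\<omega> x a y * r $ x * r $ y = \<omega> a x y * \<omega> x y a * r $ (x + y)" for x y
    using arg_cong[OF yd_module.coact_coassoc[OF yd, of m], of "\<lambda>v. v $ (x, y, i)"] i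
    unfolding coassoc_left_weight_vector[OF M m] coassoc_right_weight_vector[OF M m] by simp
  have 3: "r $ x \<noteq> 0" for x
    using 2[of x "- x"] 1 by auto
  have "a + x = x + a" for x
    using arg_cong[OF yd_module.act_coact[OF yd, of "bvec (x + a)" m], of "\<lambda>v. v $ (x, i)"] i 3[of x]
    unfolding act_coact_left_weight_vector[OF M m] act_coact_right_weight_vector[OF M m]
    by (auto simp: bvec_nth split: if_splits)
  then show ?thesis
    using 1 2 3 by (simp add: compatible_def)
qed

lemma yd_module_of_weight_vectors:
  assumes M: "linear_yd M" and S: "vec.span S = UNIV"
    and w: "\<And>m. m \<in> S \<Longrightarrow> \<exists>a r. weight_vector M a r m \<and> compatible a r"
  shows "yd_module H M"
proof (intro yd_module.intro yd_module_axioms.intro quasi_hopf_H)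
  show "lin (\<lambda>h. act M h m)" for m
    by (intro lin_intros M)
  show "lin (act M h)" for h
    using M by (simp add: linear_yd_def)
  show "lin (coact M)"
    using M by (simp add: linear_yd_def)
  show "act M (one H) m = m" for m
  proof (rule lin_eq_on_span[where x = m, OF _ _ S], (intro lin_intros M)+)
    fix m assume "m \<in> S"
    then obtain a r where m: "weight_vector M a r m"
      using w by blast
    show "act M (one H) m = m"
      by (simp add: weight_vector_act[OF m])
  qed
  show "act M (mul H x y) m = act M x (act M y m)" for x y m
  proof (rule lin_eq_on_span[where x = m, OF _ _ S], (intro lin_intros M)+)
    fix m assume "m \<in> S"
    then obtain a r where m: "weight_vector M a r m"
      using w by blast
    show "act M (mul H x y) m = act M x (act M y m)"
      by (simp add: weight_vector_act[OF m] weight_vector_act_scale[OF M m] mult.commute)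
  qed
  show "lift2 (coact M m) (\<lambda>m1 m0. eps H m1 *s m0) = m" for m
  proof (rule lin_eq_on_span[where x = m, OF _ _ S], (intro lin_intros M)+)
    fix m assume "m \<in> S"
    then obtain a r where m: "weight_vector M a r m" "compatible a r"
      using w by blast
    then show "lift2 (coact M m) (\<lambda>m1 m0. eps H m1 *s m0) = m"
      unfolding counit_weight_vector[OF M m(1)] by (simp add: compatible_def)
  qed
  show "lift3 (Phi H) (\<lambda>X1 X2 X3. lift2 (coact M m) (\<lambda>m1 m0.
         lift2 (coact M (act M X2 m0)) (\<lambda>n1 n0. mul H X1 m1 \<otimes> mul H n1 X3 \<otimes> n0)))
       = lift3 (Phi H) (\<lambda>X1 X2 X3. lift3 (Phi H) (\<lambda>Y1 Y2 Y3.
           lift2 (coact M (act M Y1 m)) (\<lambda>m1 m0. lift2 (cop H m1) (\<lambda>m11 m12.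
             mul H (mul H X1 m11) Y2 \<otimes> mul H (mul H X2 m12) Y3 \<otimes> act M X3 m0))))"
    (is "?L m = ?R m") for m
  proof (rule lin_eq_on_span[of ?L ?R _ m, OF _ _ S], (intro lin_intros M)+)
    fix m assume "m \<in> S"
    then obtain a r where m: "weight_vector M a r m" "compatible a r"
      using w by blast
    have "?L m $ (x, y, i) = ?R m $ (x, y, i)" for x y i
      unfolding coassoc_left_weight_vector[OF M m(1)] coassoc_right_weight_vector[OF M m(1)]
      using m(2) by (simp add: compatible_def)
    then show "?L m = ?R m"
      by (simp add: vec_eq_iff)
  qed
  show "lift2 (cop H h) (\<lambda>h1 h2. lift2 (coact M m) (\<lambda>m1 m0. mul H h1 m1 \<otimes> act M h2 m0))
       = lift2 (cop H h) (\<lambda>h1 h2.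
           lift2 (coact M (act M h1 m)) (\<lambda>m1 m0. mul H m1 h2 \<otimes> m0))"
    (is "?L m = ?R m") for h m
  proof (rule lin_eq_on_span[of ?L ?R _ m, OF _ _ S], (intro lin_intros M)+)
    fix m assume "m \<in> S"
    then obtain a r where m: "weight_vector M a r m" "compatible a r"
      using w by blast
    have "?L m $ (x, i) = ?R m $ (x, i)" for x i
      unfolding act_coact_left_weight_vector[OF M m(1)] act_coact_right_weight_vector[OF M m(1)]
      using m(2) by (simp add: compatible_def)
    then show "?L m = ?R m"
      by (simp add: vec_eq_iff)
  qed
qed

lemma tensor_weight_unit [simp]: "tensor_weight 0 1 a r = r" "tensor_weight a r 0 1 = r"
  by (simp_all add: tensor_weight_def vec_eq_iff)

lemma linear_yd_unit: "linear_yd (yd_unit H)"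
  unfolding linear_yd_def yd_unit_def yd_data.simps H_simps by (intro conjI allI lin_intros)

lemma weight_vector_yd_unit: "weight_vector (yd_unit H) 0 1 x"
  by (simp add: weight_vector_def yd_unit_def)

end


section \<open>Two-dimensional braided Hopf algebras in normal form\<close>

text \<open>
  A braided Hopf algebra of dimension two written in a basis \<open>u\<close>, \<open>n\<close> of weight vectors, with structure
  constants \<open>c\<close>, \<open>d\<close>, \<open>s\<close>. Besides linearity only the values on this basis are recorded: the Hopf algebra
  axioms are not part of the locale, so that they can be derived from the constants as well as restrict
  them.
\<close>

locale hopf_form =
  fixes B :: "('k::field, 'g::{finite, group_add}, 'i::finite) braided_hopf_data"
    and u n :: "('k, 'i) vec" and g :: 'g and r :: "('k, 'g) vec" and c d s :: 'k
  assumes linear_obj: "linear_yd (obj B)"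
    and linear: "lin (bmul B)" "lin (bunit B)" "lin (bcop B)" "lin (bcounit B)" "lin (banti B)"
    and weight_u: "weight_vector (obj B) 0 1 u"
    and weight_n: "weight_vector (obj B) g r n"
    and span: "vec.span {u, n} = UNIV"
    and n_nonzero: "n \<noteq> 0"
    and unit: "bunit B 1 = u"
    and mult: "bmul B (u \<otimes> u) = u" "bmul B (u \<otimes> n) = n" "bmul B (n \<otimes> u) = n" "bmul B (n \<otimes> n) = c *s n"
    and comult: "bcop B u = u \<otimes> u" "bcop B n = n \<otimes> u + u \<otimes> n + d *s (n \<otimes> n)"
    and counit: "bcounit B u = 1" "bcounit B n = 0"
    and antipode: "banti B u = u" "banti B n = s *s n"
begin

text \<open>
  The counit is the first coordinate functional of the basis; the second one is obtained from any
  nonvanishing coordinate of \<open>n\<close>.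
\<close>

lemma coordinates:
  "\<exists>\<beta>. (\<forall>x. x = bcounit B x $ 1 *s u + \<beta> x *s n) \<and> (\<forall>x y. \<beta> (x + y) = \<beta> x + \<beta> y) \<and>
     (\<forall>a x. \<beta> (a *s x) = a * \<beta> x) \<and> \<beta> u = 0 \<and> \<beta> n = 1"
proof -
  obtain i where i: "n $ i \<noteq> 0"
    using n_nonzero by (auto simp: vec_eq_iff)
  define \<beta> where "\<beta> x = (x - bcounit B x $ 1 *s u) $ i / n $ i" for x
  have "x = bcounit B x $ 1 *s u + \<beta> x *s n" for x
  proof -
    obtain p q where x: "x = p *s u + q *s n"
      using span_pair_expand[OF span] by blast
    have "bcounit B x = p *s 1"
      by (simp add: x lin_add[OF linear(4)] lin_scale[OF linear(4)] counit)
    then show ?thesis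
      using i by (simp add: \<beta>_def x)
  qed
  moreover have "\<beta> (x + y) = \<beta> x + \<beta> y" "\<beta> (a *s x) = a * \<beta> x" for x y a
    by (simp_all add: \<beta>_def lin_add[OF linear(4)] lin_scale[OF linear(4)]
        algebra_simps add_divide_distrib diff_divide_distrib)
  moreover have "\<beta> u = 0" "\<beta> n = 1"
    using i by (simp_all add: \<beta>_def counit)
  ultimately show ?thesis by blast
qed

lemma linear_extension:
  fixes u' n' :: "('k, 'j::finite) vec"
  obtains f where "lin f" "f u = u'" "f n = n'"
proof -
  obtain \<beta> where \<beta>: "\<And>x y. \<beta> (x + y) = \<beta> x + \<beta> y" "\<And>a x. \<beta> (a *s x) = a * \<beta> x"
    "\<beta> u = 0" "\<beta> n = 1"
    using coordinates by blast
  have "lin (\<lambda>x. bcounit B x $ 1 *s u' + \<beta> x *s n')"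
    by (rule linI) (simp_all add: \<beta>(1,2) lin_add[OF linear(4)] lin_scale[OF linear(4)] vec_eq_iff algebra_simps)
  then show ?thesis
    by (rule that) (simp_all add: \<beta> counit)
qed

lemma counit_zero_imp_multiple:
  assumes "bcounit B x = 0"
  obtains a where "x = a *s n"
proof -
  obtain \<beta> where "x = bcounit B x $ 1 *s u + \<beta> x *s n"
    using coordinates by blast
  with assms show ?thesis
    by (intro that[of "\<beta> x"]) simp
qed

end

lemma span_one: "vec.span {1 :: 'k::field ^ 1} = UNIV"
proof -
  have "x = x $ 1 *s 1" for x :: "'k ^ 1"
    by (simp add: vec_eq_iff forall_1)
  then show ?thesis
    by (auto simp: vec.span_singleton)
qed

text \<open>
  The linear map matching the two bases is an isomorphism, since everything is determined by the
  values on the basis.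
\<close>

lemma hopf_form_iso:
  fixes A :: "('k::field, 'g::{finite, group_add}, 'i::finite) braided_hopf_data"
    and B :: "('k, 'g, 'j::finite) braided_hopf_data"
  assumes "hopf_form A u n g r c d s" and "hopf_form B u' n' g r c d s"
  shows "bh_iso A B"
proof -
  interpret A: hopf_form A u n g r c d s by fact
  interpret B: hopf_form B u' n' g r c d s by fact
  note lins = lin_comp' lin_tmap A.linear B.linear
  obtain f where f: "lin f" "f u = u'" "f n = n'"
    by (rule A.linear_extension)
  note lins = lins f(1)
  obtain h where h: "lin h" "h u' = u" "h n' = n"
    by (rule B.linear_extension)
  have "h (f x) = x" for x
    by (rule lin_eq_on_span[OF lin_comp[OF h(1) f(1)] lin_id A.span]) (auto simp: f h)
  moreover have "f (h x) = x" for x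
    by (rule lin_eq_on_span[OF lin_comp[OF f(1) h(1)] lin_id B.span]) (auto simp: f h)
  ultimately have "bij f"
    by (intro o_bij[of h]) auto
  moreover have "yd_hom (obj A) (obj B) f"
    by (rule yd_homI_weight_vectors[OF A.linear_obj B.linear_obj f(1) A.span])
      (use A.weight_u A.weight_n B.weight_u B.weight_n f in auto)
  moreover have "f \<circ> bmul A = bmul B \<circ> tmap f f"
    by (rule ext, rule lin_eq_on_span2[OF _ _ A.span A.span], (intro lins)+)
      (auto simp: tmap_tens f lin_scale[OF f(1)] A.mult B.mult)
  moreover have "f \<circ> bunit A = bunit B"
    by (rule ext, rule lin_eq_on_span[OF _ _ span_one], (intro lins)+)
      (auto simp: f A.unit B.unit)
  moreover have "bcop B \<circ> f = tmap f f \<circ> bcop A"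
    by (rule ext, rule lin_eq_on_span[OF _ _ A.span], (intro lins)+)
      (auto simp: tmap_tens f lin_add[OF lin_tmap] lin_scale[OF lin_tmap] A.comult B.comult)
  moreover have "bcounit B \<circ> f = bcounit A"
    by (rule ext, rule lin_eq_on_span[OF _ _ A.span], (intro lins)+)
      (auto simp: f A.counit B.counit)
  moreover have "banti B \<circ> f = f \<circ> banti A"
    by (rule ext, rule lin_eq_on_span[OF _ _ A.span], (intro lins)+)
      (auto simp: f lin_scale[OF f(1)] A.antipode B.antipode)
  ultimately show ?thesis
    unfolding bh_iso_def by blast
qed

text \<open>
  An isomorphism respects the counits, hence sends \<open>n\<close> to a nonzero multiple of \<open>n'\<close>, and as a morphism
  of Yetter-Drinfeld modules it preserves the weight.
\<close>

lemma hopf_form_iso_weight: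
  assumes "hopf_form A u n g r c d s" and "hopf_form B u' n' g' r' c' d' s'" and "bh_iso A B"
  shows "g = g'" "r = r'"
proof -
  interpret A: hopf_form A u n g r c d s by fact
  interpret B: hopf_form B u' n' g' r' c' d' s' by fact
  obtain f where f: "bij f" "yd_hom (obj A) (obj B) f" "bcounit B \<circ> f = bcounit A"
    using assms(3) unfolding bh_iso_def by blast
  have "lin f"
    using f(2) by (simp add: yd_hom_def)
  then have nz: "f n \<noteq> 0"
    using A.n_nonzero f(1) by (metis bij_pointE lin_zero)
  have "bcounit B (f n) = 0"
    using fun_cong[OF f(3), of n] A.counit by simp
  then obtain a where "f n = a *s n'"
    by (rule B.counit_zero_imp_multiple)
  then have "weight_vector (obj B) g' r' (f n)"
    by (simp add: weight_vector_scale B.linear_obj B.weight_n)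
  moreover have "weight_vector (obj B) g r (f n)"
    by (rule yd_hom_weight_vector[OF f(2) A.weight_n])
  ultimately show "g = g'" "r = r'"
    using weight_vector_unique nz by blast+
qed

lemma lunit_tens: "lunit (x \<otimes> m) = x $ 1 *s m"
  unfolding lunit_def by (subst lift2_tens) (intro lin_intros refl)+

lemma runit_tens: "runit (m \<otimes> x) = x $ 1 *s m"
  unfolding runit_def by (subst lift2_tens) (intro lin_intros refl)+

lemma lin_lunit: "lin lunit" and lin_runit: "lin runit"
  unfolding lunit_def[abs_def] runit_def[abs_def] by (intro lin_intros)+

lemma lin_id': "lin id"
  by (simp add: lin_iff)

locale cocycle_hopf_form = group_cocycle \<omega> + hopf_form B u n g r c d s
  for \<omega> :: "'g::{finite, group_add} \<Rightarrow> 'g \<Rightarrow> 'g \<Rightarrow> 'k::field"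
    and B :: "('k, 'g, 'i::finite) braided_hopf_data" and u n g r c d s
begin

lemmas bmul2_basis =
    bmul2_weight_vectors[OF linear_obj linear(1) weight_u weight_u weight_u weight_u]
    bmul2_weight_vectors[OF linear_obj linear(1) weight_u weight_u weight_u weight_n]
    bmul2_weight_vectors[OF linear_obj linear(1) weight_u weight_u weight_n weight_u]
    bmul2_weight_vectors[OF linear_obj linear(1) weight_u weight_u weight_n weight_n]
    bmul2_weight_vectors[OF linear_obj linear(1) weight_u weight_n weight_u weight_u]
    bmul2_weight_vectors[OF linear_obj linear(1) weight_u weight_n weight_u weight_n]
    bmul2_weight_vectors[OF linear_obj linear(1) weight_u weight_n weight_n weight_u]
    bmul2_weight_vectors[OF linear_obj linear(1) weight_u weight_n weight_n weight_n]
    bmul2_weight_vectors[OF linear_obj linear(1) weight_n weight_u weight_u weight_u]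
    bmul2_weight_vectors[OF linear_obj linear(1) weight_n weight_u weight_u weight_n]
    bmul2_weight_vectors[OF linear_obj linear(1) weight_n weight_u weight_n weight_u]
    bmul2_weight_vectors[OF linear_obj linear(1) weight_n weight_u weight_n weight_n]
    bmul2_weight_vectors[OF linear_obj linear(1) weight_n weight_n weight_u weight_u]
    bmul2_weight_vectors[OF linear_obj linear(1) weight_n weight_n weight_u weight_n]
    bmul2_weight_vectors[OF linear_obj linear(1) weight_n weight_n weight_n weight_u]
    bmul2_weight_vectors[OF linear_obj linear(1) weight_n weight_n weight_n weight_n]

lemmas yd_assoc_basis =
    yd_assoc_weight_vectors[OF linear_obj linear_obj linear_obj weight_u weight_u weight_u]
    yd_assoc_weight_vectors[OF linear_obj linear_obj linear_obj weight_u weight_u weight_n]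
    yd_assoc_weight_vectors[OF linear_obj linear_obj linear_obj weight_u weight_n weight_u]
    yd_assoc_weight_vectors[OF linear_obj linear_obj linear_obj weight_u weight_n weight_n]
    yd_assoc_weight_vectors[OF linear_obj linear_obj linear_obj weight_n weight_u weight_u]
    yd_assoc_weight_vectors[OF linear_obj linear_obj linear_obj weight_n weight_u weight_n]
    yd_assoc_weight_vectors[OF linear_obj linear_obj linear_obj weight_n weight_n weight_u]
    yd_assoc_weight_vectors[OF linear_obj linear_obj linear_obj weight_n weight_n weight_n]

lemmas weight_tens_basis =
  weight_vector_tens[OF linear_obj linear_obj weight_u weight_u]
  weight_vector_tens[OF linear_obj linear_obj weight_u weight_n]
  weight_vector_tens[OF linear_obj linear_obj weight_n weight_u]
  weight_vector_tens[OF linear_obj linear_obj weight_n weight_n]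

text \<open>
  All axioms are checked on tensors of basis vectors. Since \<open>\<omega>\<close> is normalized and every product with two
  factors \<open>n\<close> vanishes, associators become invisible. The value \<open>r g = -1\<close> enters through
  \<open>\<Delta>(n)\<^sup>2 = (1 + r g) (n \<otimes> n)\<close>, which has to be \<open>\<Delta>(n\<^sup>2) = 0\<close>.
\<close>

lemma braided_hopf_algebra_normal_form:
  assumes "compatible g r" and "r $ g = - 1" and "c = 0" "d = 0" "s = - 1"
  shows "braided_hopf_algebra H B"
proof (rule braided_hopf_algebra.intro)
  note lins = lin_comp' lin_tmap lin_id' linear lin_lunit lin_runit lin_bmul2 lin_yd_assoc
  note V = linear_obj
  note VV = linear_yd_tensor[OF V V]
  have r0: "r $ 0 = 1"
    using assms(1) by (simp add: compatible_def)
  note ev = r0 tmap_tens lins lin_id mult comult counit antipode unit assms lunit_tens runit_tens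
    lin_add[OF lin_tmap] lin_scale[OF lin_tmap] lin_add[OF linear(1)] lin_scale[OF linear(1)]
    lin_zero[OF linear(1)] lin_zero[OF linear(2)] lin_zero[OF linear(3)]
    lin_add[OF lin_yd_assoc] lin_add[OF lin_bmul2] lin_add[OF lin_lunit] lin_add[OF lin_runit]
    tens_add_left tens_add_right tens_minus_left tens_minus_right lin_minus[OF linear(1)]
    lin_diff[OF linear(1)]
  show "yd_module H (obj B)"
    by (rule yd_module_of_weight_vectors[OF V span])
      (use weight_u weight_n compatible_unit assms in auto)
  show "yd_hom (yd_tensor H (obj B) (obj B)) (obj B) (bmul B)"
  proof (rule yd_homI_weight_vectors[OF VV V linear(1) span_tens[OF span span]])
    fix m assume "m \<in> {a \<otimes> b |a b. a \<in> {u, n} \<and> b \<in> {u, n}}"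
    then have "m \<in> {u \<otimes> u, u \<otimes> n, n \<otimes> u, n \<otimes> n}" by auto
    then show "\<exists>a r. weight_vector (yd_tensor H (obj B) (obj B)) a r m \<and> weight_vector (obj B) a r (bmul B m)"
      using weight_tens_basis weight_u weight_n weight_vector_zero[OF V]
      by (elim insertE emptyE; simp add: mult assms; blast)
  qed
  show "yd_hom (yd_unit H) (obj B) (bunit B)"
    by (rule yd_homI_weight_vectors[OF linear_yd_unit V linear(2) span_one])
      (use weight_vector_yd_unit weight_u unit in auto)
  show "yd_hom (obj B) (yd_tensor H (obj B) (obj B)) (bcop B)"
  proof (rule yd_homI_weight_vectors[OF V VV linear(3) span])
    fix m assume m: "m \<in> {u, n}"
    have "weight_vector (yd_tensor H (obj B) (obj B)) 0 1 (u \<otimes> u)"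
      "weight_vector (yd_tensor H (obj B) (obj B)) g r (n \<otimes> u + u \<otimes> n)"
      using weight_tens_basis by (auto intro: weight_vector_add[OF VV])
    then show "\<exists>a r. weight_vector (obj B) a r m \<and> weight_vector (yd_tensor H (obj B) (obj B)) a r (bcop B m)"
      using m weight_u weight_n by (elim insertE emptyE; simp add: comult assms; blast)
  qed
  show "yd_hom (obj B) (yd_unit H) (bcounit B)"
    by (rule yd_homI_weight_vectors[OF V linear_yd_unit linear(4) span])
      (use weight_vector_yd_unit weight_vector_zero[OF linear_yd_unit] weight_u weight_n counit in
        \<open>elim insertE emptyE; simp; blast\<close>)
  show "yd_hom (obj B) (obj B) (banti B)"
    by (rule yd_homI_weight_vectors[OF V V linear(5) span])
      (use weight_vector_scale[OF V weight_n] weight_u weight_n antipode in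
        \<open>elim insertE emptyE; simp; blast\<close>)
  show "bmul B \<circ> tmap (bmul B) id = bmul B \<circ> tmap id (bmul B) \<circ> yd_assoc H (obj B) (obj B) (obj B)"
    by (rule ext, rule lin_eq_on_span2[OF _ _ span_tens[OF span span] span], (intro lins)+)
      (auto simp: ev yd_assoc_basis)
  show "bmul B \<circ> tmap (bunit B) id = lunit"
    by (rule ext, rule lin_eq_on_span2[OF _ _ span_one span], (intro lins)+) (auto simp: ev)
  show "bmul B \<circ> tmap id (bunit B) = runit"
    by (rule ext, rule lin_eq_on_span2[OF _ _ span span_one], (intro lins)+) (auto simp: ev)
  show "yd_assoc H (obj B) (obj B) (obj B) \<circ> tmap (bcop B) id \<circ> bcop B = tmap id (bcop B) \<circ> bcop B"
    by (rule ext, rule lin_eq_on_span[OF _ _ span], (intro lins)+)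
      (auto simp: ev yd_assoc_basis)
  show "lunit \<circ> tmap (bcounit B) id \<circ> bcop B = id"
    by (rule ext, rule lin_eq_on_span[OF _ _ span], (intro lins)+) (auto simp: ev)
  show "runit \<circ> tmap id (bcounit B) \<circ> bcop B = id"
    by (rule ext, rule lin_eq_on_span[OF _ _ span], (intro lins)+) (auto simp: ev)
  show "bcop B \<circ> bmul B = bmul2 H B \<circ> tmap (bcop B) (bcop B)"
    by (rule ext, rule lin_eq_on_span2[OF _ _ span span], (intro lins)+)
      (auto simp: ev bmul2_basis)
  show "bcop B (bunit B 1) = bunit B 1 \<otimes> bunit B 1"
    by (simp add: ev)
  show "bcounit B \<circ> bmul B = lunit \<circ> tmap (bcounit B) (bcounit B)"
    by (rule ext, rule lin_eq_on_span2[OF _ _ span span], (intro lins)+) (auto simp: ev lin_zero[OF linear(4)])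
  show "bcounit B \<circ> bunit B = id"
    by (rule ext, rule lin_eq_on_span[OF _ _ span_one], (intro lins)+) (auto simp: ev)
  show "bmul B \<circ> tmap (banti B) id \<circ> bcop B = bunit B \<circ> bcounit B"
    "bmul B \<circ> tmap id (banti B) \<circ> bcop B = bunit B \<circ> bcounit B"
    by (rule ext, rule lin_eq_on_span[OF _ _ span], (intro lins)+, auto simp: ev)+
qed

end


section \<open>The kernel of the counit\<close>

text \<open>
  Applying \<open>f\<close> to the second leg of a tensor can be done slice by slice. Hence a coaction whose second
  leg is killed by \<open>f\<close> takes values in \<open>H \<otimes> ker f\<close>.
\<close>

lemma lift2_tens_lin_component:
  assumes f: "lin f"
  shows "lift2 t (\<lambda>x y. x \<otimes> f y) $ (a, l) = f (\<chi> i. t $ (a, i)) $ l"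
proof -
  have "lift2 t (\<lambda>x y. x \<otimes> f y) $ (a, l)
      = (\<Sum>x\<in>UNIV. \<Sum>y\<in>UNIV. if x = a then t $ (a, y) * f (bvec y) $ l else 0)"
    unfolding lift2_def sum_component by (intro sum.cong refl) (auto simp: bvec_nth)
  also have "\<dots> = (\<Sum>y\<in>UNIV. t $ (a, y) * f (bvec y) $ l)"
    by (subst sum.swap) simp
  finally show ?thesis
    by (subst lin_expand[OF f]) (simp add: sum_component)
qed

lemma lin_expand_2: "lin f \<Longrightarrow> f (x :: 'k::field ^ 2) = x $ 1 *s f (bvec 1) + x $ 2 *s f (bvec 2)"
  by (subst lin_expand[of f x]) (simp_all add: sum_2)

text \<open>
  In coordinates \<open>n\<close> is the vector with \<open>det(x, n) = \<epsilon>(x)\<close>. Since \<open>det(u, n) = 1\<close>, Cramer's rule gives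
  \<open>x = \<epsilon>(x) u + det(u, x) n\<close>.
\<close>

lemma kernel_complement:
  fixes \<epsilon> :: "'k::field ^ 2 \<Rightarrow> 'k ^ 1" and u :: "'k ^ 2"
  assumes \<epsilon>: "lin \<epsilon>" and u: "\<epsilon> u = 1"
  obtains n where "n \<noteq> 0" "\<epsilon> n = 0" "\<And>x. \<epsilon> x = 0 \<Longrightarrow> \<exists>a. x = a *s n" "vec.span {u, n} = UNIV"
proof -
  define e1 e2 where e: "e1 = \<epsilon> (bvec 1) $ 1" "e2 = \<epsilon> (bvec 2) $ 1"
  have eps: "\<epsilon> x $ 1 = x $ 1 * e1 + x $ 2 * e2" for x
    by (subst lin_expand_2[OF \<epsilon>]) (simp add: e)
  define n :: "'k ^ 2" where "n = (\<chi> i. if i = 1 then - e2 else e1)"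
  have n: "n $ 1 = - e2" "n $ 2 = e1"
    by (simp_all add: n_def)
  have det: "u $ 1 * e1 + u $ 2 * e2 = 1"
    using u eps[of u] by simp
  have expand: "x = \<epsilon> x $ 1 *s u + (u $ 1 * x $ 2 - u $ 2 * x $ 1) *s n" for x
  proof -
    have "\<epsilon> x $ 1 * u $ 1 + (u $ 1 * x $ 2 - u $ 2 * x $ 1) * n $ 1 = x $ 1 * (u $ 1 * e1 + u $ 2 * e2)"
      "\<epsilon> x $ 1 * u $ 2 + (u $ 1 * x $ 2 - u $ 2 * x $ 1) * n $ 2 = x $ 2 * (u $ 1 * e1 + u $ 2 * e2)"
      by (simp_all add: eps n algebra_simps)
    then show ?thesis
      unfolding det vec_eq_iff forall_2 vector_add_component vector_smult_component by simp
  qed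
  show ?thesis
  proof (rule that)
    show "n \<noteq> 0"
      using det n by (auto simp: vec_eq_iff forall_2)
    show "\<epsilon> n = 0"
      by (simp add: vec_eq_iff forall_1 eps n)
    show "\<exists>a. x = a *s n" if "\<epsilon> x = 0" for x
      using expand[of x] that by (metis add.left_neutral vec.scale_zero_left zero_index)
    have "x \<in> vec.span {u, n}" for x
      by (subst expand) (intro vec.span_add vec.span_scale vec.span_base, auto)
    then show "vec.span {u, n} = UNIV" by auto
  qed
qed

lemma span_pair_tens_expand:
  fixes u n :: "'k::field ^ 'i::finite"
  assumes "vec.span {u, n} = UNIV"
  shows "\<exists>p q q' d. t = p *s (u \<otimes> u) + q *s (u \<otimes> n) + q' *s (n \<otimes> u) + d *s (n \<otimes> n)"
proof -
  have "{a \<otimes> b |a b. a \<in> {u, n} \<and> b \<in> {u, n}} = {u \<otimes> u, u \<otimes> n, n \<otimes> u, n \<otimes> n}"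
    by auto
  then have "t \<in> vec.span {u \<otimes> u, u \<otimes> n, n \<otimes> u, n \<otimes> n}"
    using span_tens[OF assms assms] by simp
  then obtain p q q' d where
    "t - p *s (u \<otimes> u) - q *s (u \<otimes> n) - q' *s (n \<otimes> u) = d *s (n \<otimes> n)"
    by (auto simp: vec.span_insert vec.span_singleton)
  then have "t = p *s (u \<otimes> u) + q *s (u \<otimes> n) + q' *s (n \<otimes> u) + d *s (n \<otimes> n)"
    by (simp add: diff_eq_eq add_ac)
  then show ?thesis by blast
qed

lemma vec_scale_eq_iff: "(n :: 'k::field ^ 'i) \<noteq> 0 \<Longrightarrow> a *s n = b *s n \<longleftrightarrow> a = b"
  by simp

lemma tens_eq_0_iff: "(u :: 'k::field ^ 'i) \<otimes> (v :: 'k ^ 'j) = 0 \<longleftrightarrow> u = 0 \<or> v = 0"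
  by (auto simp: vec_eq_iff)

context group_cocycle
begin

text \<open>
  A character \<open>\<sigma>\<close> of \<open>k\<^sup>G\<close> takes idempotents to \<open>0\<close> or \<open>1\<close>. By orthogonality at most one \<open>\<sigma>(P\<^sub>g)\<close> is nonzero,
  and one is, because the \<open>P\<^sub>g\<close> sum up to the unit.
\<close>

lemma character_is_evaluation:
  fixes M :: "('k, 'g, 'i::finite) yd_data"
  assumes M: "linear_yd M" and one: "act M 1 n = n" and mul: "\<And>x y. act M (x * y) n = act M x (act M y n)"
    and line: "\<And>h. \<exists>a. act M h n = a *s n" and nz: "n \<noteq> 0"
  shows "\<exists>g. \<forall>h. act M h n = h $ g *s n"
proof -
  obtain \<sigma> where \<sigma>: "\<And>h. act M h n = \<sigma> h *s n"
    using line by metis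
  have lin: "lin (\<lambda>h. act M h n)"
    using M by (simp add: linear_yd_def)
  have mult: "\<sigma> (x * y) = \<sigma> x * \<sigma> y" for x y
    using mul[of x y] nz by (simp add: \<sigma> weight_vector_act_scale lin_scale[of "act M x"] M[unfolded linear_yd_def] mult.commute)
  have idem: "bvec x * bvec y = (if x = y then bvec x else (0 :: ('k, 'g) vec))" for x y
    by (auto simp: vec_eq_iff bvec_nth)
  have zero: "\<sigma> 0 = 0"
    using \<sigma>[of 0] lin_zero[OF lin] nz by simp
  have "\<exists>g. \<sigma> (bvec g) \<noteq> 0"
  proof (rule ccontr)
    assume "\<nexists>g. \<sigma> (bvec g) \<noteq> 0"
    then have "act M 1 n = 0"
      by (subst lin_expand[OF lin]) (simp add: \<sigma>)
    then show False
      using one nz by simp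
  qed
  then obtain g where g: "\<sigma> (bvec g) \<noteq> 0" by blast
  then have "\<sigma> (bvec g) = 1"
    using mult[of "bvec g" "bvec g"] by (simp add: idem)
  moreover have "\<sigma> (bvec x) = 0" if "x \<noteq> g" for x
    using mult[of "bvec x" "bvec g"] that g zero by (simp add: idem)
  ultimately have "\<sigma> (bvec x) = (if x = g then 1 else 0)" for x
    by simp
  then have "h $ x *s act M (bvec x) n = (if x = g then h $ g *s n else 0)" for h x
    by (simp add: \<sigma>)
  then have "act M h n = h $ g *s n" for h
    by (subst lin_expand[OF lin]) simp
  then show ?thesis by blast
qed

text \<open>
  The kernel of the counit is closed under action, coaction and multiplication and has dimension one,
  which produces \<open>g\<close>, \<open>r\<close> and \<open>c\<close>. The counit axioms fix three of the four coefficients of \<open>\<Delta>(n)\<close>. The final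
  equation is the antipode axiom at \<open>n\<close>; its component along \<open>u\<close> shows that \<open>S(n)\<close> is a multiple of \<open>n\<close>.
\<close>

theorem braided_hopf_algebra_structure:
  fixes B :: "('k, 'g, 2) braided_hopf_data"
  assumes "braided_hopf_algebra H B"
  obtains u n g r c d s where "hopf_form B u n g r c d s" "compatible g r" "s + 1 + d * s * c = 0"
proof -
  interpret braided_hopf_algebra H B by fact
  let ?V = "obj B"
  note V = yd_module_linear_yd[OF obj_yd]
  have mul: "lin (bmul B)" and unit: "lin (bunit B)" and cop: "lin (bcop B)"
    and eps: "lin (bcounit B)" and anti: "lin (banti B)"
    using bmul_hom bunit_hom bcop_hom bcounit_hom banti_hom by (simp_all add: yd_hom_def)
  note lins = mul unit cop eps anti lin_tmap lin_id' lin_lunit lin_runit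
  define u where "u = bunit B 1"
  have u_w: "weight_vector ?V 0 1 u"
    unfolding u_def by (rule yd_hom_weight_vector[OF bunit_hom weight_vector_yd_unit])
  have eps_u: "bcounit B u = 1"
    using fun_cong[OF bcounit_unit, of 1] by (simp add: u_def)
  obtain n where n: "n \<noteq> 0" "bcounit B n = 0" "\<And>x. bcounit B x = 0 \<Longrightarrow> \<exists>a. x = a *s n"
    "vec.span {u, n} = UNIV"
    using kernel_complement[OF eps eps_u] by blast
  have eps_act: "bcounit B (act ?V h x) = h $ 0 *s bcounit B x" for h x
    using bcounit_hom by (simp add: yd_hom_def yd_unit_def)
  have "\<exists>g. \<forall>h. act ?V h n = h $ g *s n"
    using yd_module.act_one[OF obj_yd, of n] yd_module.act_mul[OF obj_yd, of _ _ n]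
    by (intro character_is_evaluation[OF V] n) (simp_all add: eps_act n(2))
  then obtain g where g: "\<And>h. act ?V h n = h $ g *s n" by blast
  have "\<exists>a. (\<chi> i. coact ?V n $ (x, i)) = a *s n" for x
  proof (rule n(3))
    have "lift2 (coact ?V n) (\<lambda>m1 m0. m1 \<otimes> bcounit B m0) = coact (yd_unit H) (bcounit B n)"
      using bcounit_hom by (simp add: yd_hom_def)
    also have "\<dots> = 0"
      by (simp add: yd_unit_def n(2))
    finally have "bcounit B (\<chi> i. coact ?V n $ (x, i)) $ 1 = 0"
      by (simp flip: lift2_tens_lin_component[OF eps])
    then show "bcounit B (\<chi> i. coact ?V n $ (x, i)) = 0"
      by (simp add: vec_eq_iff forall_1)
  qed
  then obtain \<rho> where \<rho>: "\<And>x. (\<chi> i. coact ?V n $ (x, i)) = \<rho> x *s n" by metis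
  define r where "r = (\<chi> x. \<rho> x)"
  have "coact ?V n $ (x, i) = (r \<otimes> n) $ (x, i)" for x i
    using arg_cong[OF \<rho>[of x], of "\<lambda>v. v $ i"] by (simp add: r_def)
  then have n_w: "weight_vector ?V g r n"
    unfolding weight_vector_def using g by (auto simp: vec_eq_iff)
  have eps_mul: "bcounit B (bmul B (x \<otimes> y)) = bcounit B x $ 1 *s bcounit B y" for x y
    using fun_cong[OF bcounit_mul, of "x \<otimes> y"] by (simp add: tmap_tens lins lunit_tens)
  have mul_u: "bmul B (u \<otimes> x) = x" "bmul B (x \<otimes> u) = x" for x
    using fun_cong[OF bmul_unit_left, of "1 \<otimes> x"] fun_cong[OF bmul_unit_right, of "x \<otimes> 1"]
    by (simp_all add: tmap_tens lins lunit_tens runit_tens u_def)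
  obtain c where c: "bmul B (n \<otimes> n) = c *s n"
    using n(3)[of "bmul B (n \<otimes> n)"] by (auto simp: eps_mul n(2))
  have cop_u: "bcop B u = u \<otimes> u"
    using bcop_unit by (simp add: u_def)
  obtain p q q' d where pq: "bcop B n = p *s (u \<otimes> u) + q *s (u \<otimes> n) + q' *s (n \<otimes> u) + d *s (n \<otimes> n)"
    using span_pair_tens_expand[OF n(4)] by blast
  have left: "p *s u + q *s n = n"
    using fun_cong[OF bcop_counit_left, of n]
    by (simp add: pq lin_add[OF lin_tmap] lin_scale[OF lin_tmap] tmap_tens lins lin_add[OF lin_lunit]
        lin_scale[OF lin_lunit] lunit_tens eps_u n(2) lin_zero[OF lin_lunit])
  have right: "p *s u + q' *s n = n"
    using fun_cong[OF bcop_counit_right, of n]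
    by (simp add: pq lin_add[OF lin_tmap] lin_scale[OF lin_tmap] tmap_tens lins lin_add[OF lin_runit]
        lin_scale[OF lin_runit] runit_tens eps_u n(2) lin_zero[OF lin_runit])
  have "bcounit B (p *s u + q *s n) = p *s 1"
    by (simp add: lin_add[OF eps] lin_scale[OF eps] eps_u n(2))
  then have p: "p = 0"
    by (simp add: left n(2) vec_eq_iff)
  have "q = 1" "q' = 1"
    using left right n(1) vec_scale_eq_iff[of n q 1] vec_scale_eq_iff[of n q' 1] by (simp_all add: p)
  then have cop_n: "bcop B n = n \<otimes> u + u \<otimes> n + d *s (n \<otimes> n)"
    by (simp add: pq p)
  have anti_u: "banti B u = u"
    using fun_cong[OF banti_left, of u] by (simp add: cop_u tmap_tens lins mul_u eps_u u_def[symmetric])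
  obtain a s where as: "banti B n = a *s u + s *s n"
    using span_pair_expand[OF n(4)] by blast
  have anti_n: "a *s u + (a * d + (s + 1 + d * s * c)) *s n = 0"
    using fun_cong[OF banti_left, of n]
    by (simp add: cop_n as anti_u tmap_tens lins lin_add[OF lin_tmap] lin_scale[OF lin_tmap]
        lin_add[OF mul] lin_scale[OF mul] mul_u c n(2) lin_zero[OF unit] tens_add_left)
      (simp add: vec_eq_iff algebra_simps)
  have "bcounit B (a *s u + (a * d + (s + 1 + d * s * c)) *s n) = 0"
    unfolding anti_n by (rule lin_zero[OF eps])
  then have "a *s (1 :: 'k ^ 1) = 0"
    by (simp only: lin_add[OF eps] lin_scale[OF eps] eps_u n(2)) simp
  then have a: "a = 0"
    by (simp add: vec_eq_iff)
  have "(s + 1 + d * s * c) *s n = 0"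
    using anti_n by (simp only: a vec.scale_zero_left mult_zero_left add_0)
  then have "s + 1 + d * s * c = 0"
    using n(1) vec.scale_eq_0_iff by blast
  moreover have "hopf_form B u n g r c d s"
    by (rule hopf_form.intro)
      (simp_all add: V mul unit cop eps anti u_w n_w n mul_u c cop_u cop_n eps_u anti_u as a
        flip: u_def)
  moreover have "compatible g r"
    by (rule compatible_weight_vector[OF obj_yd n_w n(1)])
  ultimately show ?thesis
    by (intro that)
qed

end


section \<open>The classification\<close>

lemma two_eq_zero: "(2 :: 2) = 0"
  using exhaust_2[of 0] by auto

lemma minus_one_eq_one: "(- 1 :: 2) = 1"
  by (rule minus_unique) (simp add: two_eq_zero)

lemma two_neq_zero:
  assumes "CHAR('k::field) \<noteq> 2"
  shows "(2 :: 'k) \<noteq> 0"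
proof
  assume "(2 :: 'k) = 0"
  then have "CHAR('k) dvd 2"
    by (simp flip: of_nat_eq_0_iff_char_dvd)
  moreover have "\<not> CHAR('k) dvd 1"
    by (simp flip: of_nat_eq_0_iff_char_dvd)
  ultimately show False
    using assms two_is_prime_nat by (metis one_dvd prime_nat_iff dvd_refl)
qed

context cocycle_hopf_form
begin

text \<open>
  From \<open>g = g + g\<close> follows \<open>g = 0\<close>, where \<open>\<omega>\<close> is trivial; then \<open>r = r\<^sup>2\<close> without zeros.
\<close>

lemma same_weight_as_square:
  assumes "compatible g r" and "weight_vector M g r m"
    and "weight_vector M (g + g) (tensor_weight g r g r) m" and "m \<noteq> 0"
  shows "g = 0" "r = 1"
proof -
  have gg: "g = g + g" and r: "r = tensor_weight g r g r"
    by (rule weight_vector_unique[OF assms(2,3,4)])+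
  have "g + g = g + 0"
    by (simp only: gg[symmetric] add_0_right)
  then show g: "g = 0"
    by (rule iffD1[OF add_left_cancel])
  have "r $ x = r $ x * r $ x" for x
    using arg_cong[OF r, of "\<lambda>v. v $ x"] by (simp add: tensor_weight_def g)
  then show "r = 1"
    using assms(1) by (simp add: compatible_def vec_eq_iff)
qed

text \<open>
  Morphisms preserve weights. The multiplication maps \<open>n \<otimes> n\<close> to \<open>c n\<close>; and \<open>d (n \<otimes> n)\<close> is the difference
  of \<open>\<Delta>(n)\<close> and \<open>n \<otimes> u + u \<otimes> n\<close>, both of which have the weight of \<open>n\<close>. So a nonzero \<open>c\<close> or \<open>d\<close> makes the
  weights of \<open>n\<close> and \<open>n \<otimes> n\<close> coincide.
\<close>

lemma trivial_weight:
  assumes B: "braided_hopf_algebra H B" and cg: "compatible g r" and "c \<noteq> 0 \<or> d \<noteq> 0"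
  shows "g = 0 \<and> r = 1"
proof -
  interpret B: braided_hopf_algebra H B by fact
  note VV = linear_yd_tensor[OF linear_obj linear_obj]
  have ?thesis if c: "c \<noteq> 0"
  proof -
    have "weight_vector (obj B) (g + g) (tensor_weight g r g r) (c *s n)"
      using yd_hom_weight_vector[OF B.bmul_hom weight_tens_basis(4)] by (simp add: mult)
    moreover have "weight_vector (obj B) g r (c *s n)"
      by (rule weight_vector_scale[OF linear_obj weight_n])
    moreover have "c *s n \<noteq> 0"
      using c n_nonzero by simp
    ultimately show ?thesis
      using same_weight_as_square[OF cg] by blast
  qed
  moreover have ?thesis if d: "d \<noteq> 0"
  proof -
    have "weight_vector (yd_tensor H (obj B) (obj B)) g r (n \<otimes> u)"
      "weight_vector (yd_tensor H (obj B) (obj B)) g r (u \<otimes> n)"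
      using weight_tens_basis(2,3) by simp_all
    then have "weight_vector (yd_tensor H (obj B) (obj B)) g r (bcop B n + (- 1) *s (n \<otimes> u + u \<otimes> n))"
      by (intro weight_vector_add[OF VV] weight_vector_scale[OF VV]
          yd_hom_weight_vector[OF B.bcop_hom weight_n])
    also have "bcop B n + (- 1) *s (n \<otimes> u + u \<otimes> n) = d *s (n \<otimes> n)"
      by (simp add: comult vec_eq_iff)
    finally have n: "weight_vector (yd_tensor H (obj B) (obj B)) g r (d *s (n \<otimes> n))" .
    have nn: "weight_vector (yd_tensor H (obj B) (obj B)) (g + g) (tensor_weight g r g r) (d *s (n \<otimes> n))"
      by (intro weight_vector_scale[OF VV] weight_tens_basis)
    have "d *s (n \<otimes> n) \<noteq> 0"
      using d n_nonzero by (simp add: tens_eq_0_iff)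
    then show ?thesis
      using same_weight_as_square[OF cg n nn] by simp
  qed
  ultimately show ?thesis
    using assms(3) by blast
qed

text \<open>
  In the case \<open>c = d = 0\<close> the expansion of \<open>\<Delta>(n)\<^sup>2\<close> is \<open>(1 + r g) (n \<otimes> n)\<close>. Otherwise the braiding is the
  flip, the coefficient of \<open>n \<otimes> n\<close> yields \<open>(c d + 1) (c d + 2) = 0\<close>, and the antipode equation
  \<open>s (c d + 1) = -1\<close> rules out the first factor.
\<close>

lemma comult_square:
  assumes B: "braided_hopf_algebra H B" and cg: "compatible g r" and s: "s + 1 + d * s * c = 0"
  shows "c = 0 \<and> d = 0 \<and> s = - 1 \<and> r $ g = - 1 \<or> g = 0 \<and> r = 1 \<and> c * d = - 2 \<and> s = 1"
proof -
  interpret B: braided_hopf_algebra H B by fact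
  have "bcop B (bmul B (n \<otimes> n)) = bmul2 H B (tmap (bcop B) (bcop B) (n \<otimes> n))"
    using fun_cong[OF B.bcop_mul, of "n \<otimes> n"] by simp
  then have sq: "c *s bcop B n = bmul2 H B (bcop B n \<otimes> bcop B n)"
    by (simp add: mult tmap_tens linear lin_scale[OF linear(3)])
  have nn: "n \<otimes> n \<noteq> 0"
    using n_nonzero by (simp add: tens_eq_0_iff)
  show ?thesis
  proof (cases "c = 0 \<and> d = 0")
    case True
    then have "bmul2 H B ((n \<otimes> u + u \<otimes> n) \<otimes> (n \<otimes> u + u \<otimes> n)) = 0"
      using sq by (simp add: comult)
    then have "(1 + r $ g) *s (n \<otimes> n) = 0"
      using True by (simp add: tens_add_left tens_add_right lin_add[OF lin_bmul2] bmul2_basis mult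
          vec.scale_left_distrib add.commute)
    then have "1 + r $ g = 0"
      using nn vec.scale_eq_0_iff by blast
    then show ?thesis
      using True s by (simp add: eq_neg_iff_add_eq_0 add.commute)
  next
    case False
    then have triv: "g = 0" "r = 1"
      using trivial_weight[OF B cg] by auto
    have "c *s (n \<otimes> u) + c *s (u \<otimes> n) + (c * d) *s (n \<otimes> n)
        = c *s (n \<otimes> u) + c *s (u \<otimes> n) + (2 + 4 * (c * d) + (c * d) * (c * d)) *s (n \<otimes> n)"
    proof -
      have "c *s (n \<otimes> u) + c *s (u \<otimes> n) + (c * d) *s (n \<otimes> n) = c *s bcop B n"
        by (simp add: comult vec_eq_iff algebra_simps)
      also have "\<dots> = bmul2 H B (bcop B n \<otimes> bcop B n)"
        by (rule sq)
      also have "\<dots> = c *s (n \<otimes> u) + c *s (u \<otimes> n) + (2 + 4 * (c * d) + (c * d) * (c * d)) *s (n \<otimes> n)"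
        unfolding comult(2) tens_add_left tens_add_right lin_add[OF lin_bmul2]
        by (simp add: lin_scale[OF lin_bmul2] bmul2_basis mult triv) (simp add: vec_eq_iff algebra_simps)
      finally show ?thesis .
    qed
    then have "c * d = 2 + 4 * (c * d) + (c * d) * (c * d)"
      using nn by (simp only: add_left_cancel vec.scale_cancel_right) simp
    then have "(c * d + 1) * (c * d + 2) = 0"
      by (simp add: algebra_simps)
    moreover have "s * (c * d + 1) = - 1"
      using s by (simp add: algebra_simps eq_neg_iff_add_eq_0)
    ultimately have "c * d + 2 = 0"
      by auto
    then have cd: "c * d = - 2"
      by (simp add: eq_neg_iff_add_eq_0)
    then have "s = 1"
      using \<open>s * (c * d + 1) = - 1\<close> by simp
    then show ?thesis
      using triv cd by simp
  qed
qed

end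

lemma on_basis_eq: "on_basis u w x = x $ 1 *s u + x $ 2 *s w"
  by (simp add: on_basis_def lin_ext_def sum_2)

lemma lin_on_basis [lin_intros]: "lin (on_basis u w)"
  unfolding on_basis_def by (intro lin_intros)

lemma on_basis_bvec [simp]: "on_basis u w (bvec 1) = u" "on_basis u w (bvec 2) = w"
  by (simp_all add: on_basis_def)

lemma bvec_neq_0: "(bvec i :: 'k::field ^ 'i) \<noteq> 0"
  by (simp add: axis_eq_0_iff)

lemma span_bvec_2: "vec.span {bvec 1, bvec 2 :: 'k::field ^ 2} = UNIV"
proof -
  have "x $ 1 *s bvec 1 + x $ 2 *s bvec 2 \<in> vec.span {bvec 1, bvec 2 :: 'k ^ 2}" for x :: "'k ^ 2"
    by (intro vec.span_add vec.span_scale vec.span_base) auto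
  moreover have "x = x $ 1 *s bvec 1 + x $ 2 *s bvec 2" for x :: "'k ^ 2"
    by (subst vec_expand) (simp add: sum_2)
  ultimately show ?thesis by auto
qed

context group_cocycle
begin

lemma couple_hopf_form:
  "hopf_form (couple_hopf \<omega> g \<rho>) (bvec 1) (bvec 2) g (\<chi> x. \<rho> x) 0 0 (- 1)"
proof -
  let ?B = "couple_hopf \<omega> g \<rho>"
  have sum: "(\<Sum>x\<in>UNIV. \<rho> x *s bvec x) = (\<chi> x. \<rho> x)"
    by (subst vec_expand) simp
  have mul: "bmul ?B (a \<otimes> b) = on_basis b (on_basis (bvec 2) 0 b) a" for a b
    unfolding couple_hopf_def Let_def braided_hopf_data.simps on_basis_eq
    by (subst lift2_tens) (intro lin_intros refl)+
  have act: "act (obj ?B) h x = x $ 1 *s (h $ 0 *s bvec 1) + x $ 2 *s (h $ g *s bvec 2)" for h x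
    by (simp add: couple_hopf_def Let_def on_basis_eq)
  have coact: "coact (obj ?B) = on_basis (1 \<otimes> bvec 1) ((\<chi> x. \<rho> x) \<otimes> bvec 2)"
    by (simp add: couple_hopf_def Let_def sum)
  have mul_def: "bmul ?B = (\<lambda>t. lift2 t (\<lambda>a b. on_basis b (on_basis (bvec 2) 0 b) a))"
    by (simp add: couple_hopf_def Let_def)
  have others: "bunit ?B = lin_ext (\<lambda>_. bvec 1)" "bcounit ?B = on_basis 1 0"
    "bcop ?B = on_basis (bvec 1 \<otimes> bvec 1) (bvec 2 \<otimes> bvec 1 + bvec 1 \<otimes> bvec 2)"
    "banti ?B = on_basis (bvec 1) (- bvec 2)"
    by (simp_all add: couple_hopf_def Let_def)
  show ?thesis
  proof (rule hopf_form.intro)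
    show "linear_yd (obj ?B)"
      unfolding linear_yd_def act coact by (intro conjI allI lin_intros)
    show "lin (bmul ?B)" "lin (bunit ?B)" "lin (bcop ?B)" "lin (bcounit ?B)" "lin (banti ?B)"
      unfolding mul_def others by (intro lin_intros)+
    show "weight_vector (obj ?B) 0 1 (bvec 1)" "weight_vector (obj ?B) g (\<chi> x. \<rho> x) (bvec 2)"
      by (simp_all add: weight_vector_def act coact bvec_nth)
    show "bunit ?B 1 = bvec 1"
      by (simp add: others lin_ext_def)
  qed (simp_all add: mul others span_bvec_2 bvec_neq_0)
qed

text \<open>
  The kernel of the counit of \<open>k[C\<^sub>2]\<close> is spanned by \<open>x - 1\<close> with \<open>x\<close> the generator. Rescaling this vector
  by \<open>d\<^sup>-\<^sup>1\<close> realizes all constants with \<open>c d = -2\<close>.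
\<close>

lemma group_hopf_form:
  assumes "d \<noteq> 0" and "c * d = - 2"
  shows "hopf_form (group_hopf H :: ('k, 'g, 2) braided_hopf_data) (bvec 0) (inverse d *s (bvec 1 - bvec 0)) 0 1 c d 1"
proof -
  let ?B = "group_hopf H :: ('k, 'g, 2) braided_hopf_data"
  have mul: "bmul ?B (bvec a \<otimes> bvec b) = bvec (a + b)" for a b
    by (simp add: group_hopf_def bvec_tens)
  have lmul: "lin (bmul ?B)"
    by (simp add: group_hopf_def lin_intros)
  note mul_add = lin_add[OF lmul] lin_scale[OF lmul]
  have others: "bunit ?B = lin_ext (\<lambda>_. bvec 0)" "bcounit ?B = lin_ext (\<lambda>_. 1)"
    "bcop ?B = lin_ext (\<lambda>a. bvec a \<otimes> bvec a)" "banti ?B = lin_ext (\<lambda>a. bvec (- a))"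
    "obj ?B = \<lparr>act = (\<lambda>h b. h $ 0 *s b), coact = (\<lambda>b. 1 \<otimes> b)\<rparr>"
    by (simp_all add: group_hopf_def)
  have diff: "bvec 1 - bvec 0 = bvec 1 + (- 1) *s (bvec 0 :: 'k ^ 2)"
    by (simp add: vec_eq_iff)
  have c: "c = - (2 * inverse d)"
    using assms by (simp add: field_simps)
  note ext = lin_add[OF lin_lin_ext] lin_diff[OF lin_lin_ext] lin_scale[OF lin_lin_ext]
  show ?thesis
    unfolding diff
  proof (rule hopf_form.intro)
    show "linear_yd (obj ?B)"
      unfolding linear_yd_def others yd_data.simps by (intro conjI allI lin_intros)
    show "lin (bmul ?B)" by (rule lmul)
    show "lin (bunit ?B)" "lin (bcop ?B)" "lin (bcounit ?B)" "lin (banti ?B)"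
      unfolding others by (intro lin_intros)+
    have weight: "weight_vector (obj ?B) 0 1 x" for x
      by (simp add: weight_vector_def others)
    show "weight_vector (obj ?B) 0 1 (bvec 0)"
      "weight_vector (obj ?B) 0 1 (inverse d *s (bvec 1 + (- 1) *s bvec 0))"
      by (rule weight)+
    show "bunit ?B 1 = bvec 0"
      by (simp add: others lin_ext_def)
    let ?n = "inverse d *s (bvec 1 + (- 1) *s bvec 0) :: 'k ^ 2"
    have "bvec 1 = d *s ?n + 1 *s bvec 0"
      using assms by (simp add: vec_eq_iff)
    also have "\<dots> \<in> vec.span {bvec 0, ?n}"
      by (intro vec.span_add vec.span_scale vec.span_base) auto
    finally have "{bvec 1, bvec 2} \<subseteq> vec.span {bvec 0, ?n}"
      unfolding two_eq_zero by (auto intro: vec.span_base)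
    from vec.span_mono[OF this] show "vec.span {bvec 0, ?n} = UNIV"
      by (auto simp: span_bvec_2 vec.span_span)
    show "?n \<noteq> 0"
      using assms by (auto simp: vec_eq_iff bvec_nth)
    show "bmul ?B (bvec 0 \<otimes> bvec 0) = bvec 0" "bmul ?B (bvec 0 \<otimes> ?n) = ?n" "bmul ?B (?n \<otimes> bvec 0) = ?n"
      by (simp_all only: tens_add_left tens_add_right tens_scale_left tens_scale_right mul_add mul) simp_all
    show "bmul ?B (?n \<otimes> ?n) = c *s ?n"
      by (simp only: tens_add_left tens_add_right tens_scale_left tens_scale_right mul_add mul c)
        (simp add: two_eq_zero vec_eq_iff algebra_simps)
    show "bcop ?B (bvec 0) = bvec 0 \<otimes> bvec 0" "bcounit ?B (bvec 0) = 1" "banti ?B (bvec 0) = bvec 0"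
      "bcounit ?B ?n = 0" "banti ?B ?n = 1 *s ?n"
      by (simp_all add: others ext minus_one_eq_one)
    show "bcop ?B ?n = ?n \<otimes> bvec 0 + bvec 0 \<otimes> ?n + d *s (?n \<otimes> ?n)"
      unfolding others ext lin_ext_bvec
      using assms(1) by (simp add: tens_add_left tens_add_right) (simp add: vec_eq_iff field_simps)
  qed
qed

definition has_couple :: "('k, 'g, 2) braided_hopf_data \<Rightarrow> 'g \<Rightarrow> ('g \<Rightarrow> 'k) \<Rightarrow> bool" where
  "has_couple B g \<rho> \<longleftrightarrow> (\<exists>u n. hopf_form B u n g (\<chi> x. \<rho> x) 0 0 (- 1))"

text \<open>
  Characteristic other than two enters through \<open>c d = -2 \<noteq> 0\<close>: the exceptional constants then have
  \<open>d \<noteq> 0\<close> and belong to \<open>k[C\<^sub>2]\<close>.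
\<close>

lemma nontrivial_has_couple:
  assumes char: "CHAR('k) \<noteq> 2" and B: "B \<in> nontrivial_bh2 H"
  obtains g \<rho> where "(g, \<rho>) \<in> couples \<omega>" "has_couple B g \<rho>"
proof -
  have Bh: "braided_hopf_algebra H B" and nt: "\<not> bh_iso B (group_hopf H :: ('k, 'g, 2) braided_hopf_data)"
    using B by (simp_all add: nontrivial_bh2_def)
  obtain u n g r c d s where form: "hopf_form B u n g r c d s" and cg: "compatible g r"
    and s: "s + 1 + d * s * c = 0"
    using braided_hopf_algebra_structure[OF Bh] by blast
  interpret cocycle_hopf_form \<omega> B u n g r c d s
    by (intro cocycle_hopf_form.intro form group_cocycle_axioms)
  note two = two_neq_zero[OF char]
  have "\<not> (g = 0 \<and> r = 1 \<and> c * d = - 2 \<and> s = 1)"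
  proof
    assume *: "g = 0 \<and> r = 1 \<and> c * d = - 2 \<and> s = 1"
    then have "d \<noteq> 0"
      using two by auto
    then show False
      using * nt hopf_form_iso[OF form] group_hopf_form[of d c] by auto
  qed
  then have 1: "c = 0" "d = 0" "s = - 1" "r $ g = - 1"
    using comult_square[OF Bh cg s] by auto
  have r: "(\<chi> x. r $ x) = r"
    by (simp add: vec_eq_iff)
  show ?thesis
  proof (rule that)
    show "(g, ($) r) \<in> couples \<omega>"
      by (simp add: couples_iff r cg 1)
    show "has_couple B g (($) r)"
      using form unfolding has_couple_def r by (intro exI[of _ u] exI[of _ n]) (simp add: 1)
  qed
qed

lemma has_couple_braided:
  assumes "(g, \<rho>) \<in> couples \<omega>" "has_couple B g \<rho>"
  shows "braided_hopf_algebra H B"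
proof -
  obtain u n where "hopf_form B u n g (\<chi> x. \<rho> x) 0 0 (- 1)"
    using assms(2) by (auto simp: has_couple_def)
  then interpret cocycle_hopf_form \<omega> B u n g "\<chi> x. \<rho> x" 0 0 "- 1"
    by (intro cocycle_hopf_form.intro group_cocycle_axioms)
  show ?thesis
    using assms(1) by (intro braided_hopf_algebra_normal_form) (simp_all add: couples_iff)
qed

text \<open>
  If \<open>B\<close> were isomorphic to \<open>k[C\<^sub>2]\<close>, invariance of the weight would give \<open>\<rho> = 1\<close>, while \<open>\<rho>(g) = -1\<close>.
\<close>

lemma has_couple_nontrivial:
  assumes char: "CHAR('k) \<noteq> 2" and "(g, \<rho>) \<in> couples \<omega>" "has_couple B g \<rho>"
  shows "B \<in> nontrivial_bh2 H"
proof -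
  note two = two_neq_zero[OF char]
  obtain u n where form: "hopf_form B u n g (\<chi> x. \<rho> x) 0 0 (- 1)"
    using assms(3) by (auto simp: has_couple_def)
  have "\<not> bh_iso B (group_hopf H :: ('k, 'g, 2) braided_hopf_data)"
  proof
    assume "bh_iso B (group_hopf H :: ('k, 'g, 2) braided_hopf_data)"
    from hopf_form_iso_weight[OF form group_hopf_form[of 1 "- 2"] this]
    have "g = 0" "(\<chi> x. \<rho> x) = 1" by simp_all
    then have "\<rho> g = 1"
      by (simp add: vec_eq_iff)
    moreover have "\<rho> g = - 1"
      using assms(2) by (simp add: couples_def)
    ultimately have "1 + 1 = (0 :: 'k)"
      by (metis add.right_inverse)
    then show False
      using two by simp
  qed
  then show ?thesis
    using has_couple_braided[OF assms(2,3)] by (simp add: nontrivial_bh2_def)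
qed

lemma has_couple_iso:
  "has_couple A g \<rho> \<Longrightarrow> has_couple B g \<rho> \<Longrightarrow> bh_iso A B"
  unfolding has_couple_def by (blast intro: hopf_form_iso)

lemma has_couple_unique:
  assumes "has_couple A g \<rho>" "has_couple B g' \<rho>'" "bh_iso A B"
  shows "g = g' \<and> \<rho> = \<rho>'"
proof -
  obtain u n where A: "hopf_form A u n g (\<chi> x. \<rho> x) 0 0 (- 1)"
    using assms(1) by (auto simp: has_couple_def)
  obtain u' n' where B: "hopf_form B u' n' g' (\<chi> x. \<rho>' x) 0 0 (- 1)"
    using assms(2) by (auto simp: has_couple_def)
  have "g = g'" "(\<chi> x. \<rho> x) = (\<chi> x. \<rho>' x)"
    by (rule hopf_form_iso_weight[OF A B assms(3)])+
  then show ?thesis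
    by (simp add: vec_eq_iff fun_eq_iff)
qed

end

text \<open>
  The class of a nontrivial \<open>B\<close> consists of all algebras with the same couple \<open>(g, \<rho>)\<close>. That
  isomorphism is an equivalence relation on them is contained in this description.
\<close>

theorem proposition4p3:
  fixes \<omega> :: "'g::{finite, group_add} \<Rightarrow> 'g \<Rightarrow> 'g \<Rightarrow> 'k::field"
  assumes "CHAR('k) \<noteq> 2"
    and "normalized_cocycle3 \<omega>"
  shows "bij_betw (\<lambda>(g, \<rho>). bh2_iso_rel (fun_quasi_hopf \<omega>) `` {couple_hopf \<omega> g \<rho>})
           (couples \<omega>)
           (nontrivial_bh2 (fun_quasi_hopf \<omega>) // bh2_iso_rel (fun_quasi_hopf \<omega>))"
proof -
  interpret group_cocycle \<omega>
    by unfold_locales fact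
  note char = assms(1)
  have couple: "has_couple (couple_hopf \<omega> g \<rho>) g \<rho>" for g \<rho>
    using couple_hopf_form by (auto simp: has_couple_def)
  have cls: "bh2_iso_rel H `` {A} = {B. has_couple B g \<rho>}"
    if g: "(g, \<rho>) \<in> couples \<omega>" and A: "has_couple A g \<rho>" for A g \<rho>
  proof (intro equalityI subsetI)
    fix B assume "B \<in> bh2_iso_rel H `` {A}"
    then have B: "B \<in> nontrivial_bh2 H" and iso: "bh_iso A B"
      by (auto simp: bh2_iso_rel_def)
    obtain g' \<rho>' where "has_couple B g' \<rho>'"
      using nontrivial_has_couple[OF char B] by blast
    then show "B \<in> {B. has_couple B g \<rho>}"
      using has_couple_unique[OF A _ iso] by blast
  next
    fix B assume "B \<in> {B. has_couple B g \<rho>}"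
    then show "B \<in> bh2_iso_rel H `` {A}"
      using g A has_couple_nontrivial[OF char g] has_couple_iso[OF A] by (auto simp: bh2_iso_rel_def)
  qed
  show ?thesis
  proof (rule bij_betw_imageI)
    show "inj_on (\<lambda>(g, \<rho>). bh2_iso_rel H `` {couple_hopf \<omega> g \<rho>}) (couples \<omega>)"
    proof (rule inj_onI, clarify)
      fix g \<rho> g' \<rho>'
      assume g: "(g, \<rho>) \<in> couples \<omega>" "(g', \<rho>') \<in> couples \<omega>"
        and eq: "bh2_iso_rel H `` {couple_hopf \<omega> g \<rho>} = bh2_iso_rel H `` {couple_hopf \<omega> g' \<rho>'}"
      then have "has_couple (couple_hopf \<omega> g \<rho>) g' \<rho>'"
        using cls[OF g(1) couple] cls[OF g(2) couple] couple by blast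
      then show "g = g' \<and> \<rho> = \<rho>'"
        using has_couple_unique[OF couple _ has_couple_iso[OF couple couple]] by blast
    qed
    show "(\<lambda>(g, \<rho>). bh2_iso_rel H `` {couple_hopf \<omega> g \<rho>}) ` couples \<omega>
        = nontrivial_bh2 H // bh2_iso_rel H"
    proof (intro equalityI subsetI)
      fix X assume "X \<in> (\<lambda>(g, \<rho>). bh2_iso_rel H `` {couple_hopf \<omega> g \<rho>}) ` couples \<omega>"
      then obtain g \<rho> where "(g, \<rho>) \<in> couples \<omega>" "X = bh2_iso_rel H `` {couple_hopf \<omega> g \<rho>}"
        by auto
      then show "X \<in> nontrivial_bh2 H // bh2_iso_rel H"
        using has_couple_nontrivial[OF char _ couple] by (auto intro: quotientI)
    next
      fix X assume "X \<in> nontrivial_bh2 H // bh2_iso_rel H"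
      then obtain B where B: "B \<in> nontrivial_bh2 H" and X: "X = bh2_iso_rel H `` {B}"
        by (rule quotientE)
      obtain g \<rho> where g: "(g, \<rho>) \<in> couples \<omega>" and c: "has_couple B g \<rho>"
        using nontrivial_has_couple[OF char B] by blast
      have "X = bh2_iso_rel H `` {couple_hopf \<omega> g \<rho>}"
        unfolding X cls[OF g c] cls[OF g couple] ..
      then show "X \<in> (\<lambda>(g, \<rho>). bh2_iso_rel H `` {couple_hopf \<omega> g \<rho>}) ` couples \<omega>"
        using g by (intro image_eqI[of _ _ "(g, \<rho>)"]) auto
    qed
  qed
qed

end
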